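(* Let $V$ be a set with $|V| = n \ge 1$ and let $\Gamma$ be a (geometric) triangulation of the $(n-1)$-dimensional simplex $2^V$. Let $\mathrm{sd}(\Gamma)$ denote the barycentric subdivision of $\Gamma$, regarded as a triangulation of $2^V$. Then the local $h$-polynomial $\ell_V(\mathrm{sd}(\Gamma),x)$ is real-rooted and is interlaced by the Eulerian polynomial $A_n(x)$, i.e. $A_n(x) \preceq \ell_V(\mathrm{sd}(\Gamma),x)$.
   Context: A simplicial complex $\Delta$ is a triangulation of a simplicial complex $\Gamma$ if some geometric realization of $\Delta$ geometrically subdivides some geometric realization of $\Gamma$. The carrier of a face $G\in\Delta$ is the smallest face of $\Gamma$ whose realization contains the realization of $G$; for a face $F$ of $\Gamma$, the restriction $\Delta_F$ is the subcomplex of faces of $\Delta$ whose carrier is contained in $F$ (a triangulation of $2^F$). For a triangulation $\Delta$ of $2^V$ (carriers taken with respect to $2^V$), the $h$-polynomial of a $(d-1)$-dimensional simplicial complex $K$ is $h(K,x)=\sum_{i=0}^d f_{i-1}(K)x^i(1-x)^{d-i}$, where $f_{i}(K)$ is the number of $i$-dimensional faces and $f_{-1}=1$ (so the empty complex has $h=1$). The local $h$-polynomial is $\ell_V(\Delta,x)=\sum_{F\subseteq V}(-1)^{|V|-|F|}h(\Delta_F,x)$. The barycentric subdivision $\mathrm{sd}(\Gamma)$ is the simplicial complex of all chains in the poset of nonempty faces of $\Gamma$; it is realized as a triangulation of $\Gamma$ and hence of $2^V$. The Eulerian polynomial is $A_n(x)=\sum_{w\in\mathfrak S_n}x^{\mathrm{des}(w)}$,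 where $\mathrm{des}(w)$ is the number of $i\in[n-1]$ with $w(i)>w(i+1)$. A polynomial is real-rooted if all its roots are real or it is identically zero. For real-rooted $f$ with roots $\alpha_1\ge\alpha_2\ge\cdots$ and $g$ with roots $\beta_1\ge\beta_2\ge\cdots$, $f\preceq g$ ($f$ interlaces $g$) means $\cdots\le\alpha_2\le\beta_2\le\alpha_1\le\beta_1$; by convention the zero polynomial interlaces and is interlaced by every real-rooted polynomial, and nonzero constants interlace every polynomial of degree at most one. *)

theory Defs
  imports "HOL-Analysis.Analysis" "HOL-Combinatorics.Permutations"
    "HOL-Computational_Algebra.Polynomial"
begin

text \<open>Abstract simplicial complexes are finite and contain the empty face. A realization is
  given by the positions of the vertices; the face \<open>F\<close> is realized by the convex hull of its
  vertices, so the empty face is realized by the empty set.\<close>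

definition abstract_complex :: "'v set set \<Rightarrow> bool" where
  "abstract_complex K \<longleftrightarrow>
     finite K \<and> {} \<in> K \<and> (\<forall>F\<in>K. finite F \<and> (\<forall>G. G \<subseteq> F \<longrightarrow> G \<in> K))"

definition realize :: "('v \<Rightarrow> 'e::euclidean_space) \<Rightarrow> 'v set \<Rightarrow> 'e set" where
  "realize \<phi> F = convex hull (\<phi> ` F)"

definition geom_realization :: "('v \<Rightarrow> 'e::euclidean_space) \<Rightarrow> 'v set set \<Rightarrow> bool" where
  "geom_realization \<phi> K \<longleftrightarrow>
     abstract_complex K \<and> inj_on \<phi> (\<Union>K) \<and>
     (\<forall>F\<in>K. \<not> affine_dependent (\<phi> ` F)) \<and>
     simplicial_complex (realize \<phi> ` K)"

definition geom_subdivides :: "'e::euclidean_space set set \<Rightarrow> 'e set set \<Rightarrow> bool" where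
  "geom_subdivides T S \<longleftrightarrow> (\<forall>t\<in>T. \<exists>s\<in>S. t \<subseteq> s) \<and> \<Union>T = \<Union>S"

text \<open>\<open>\<Delta>\<close> is a triangulation of \<open>\<Gamma>\<close> by means of the realizations \<open>\<phi>\<close> of \<open>\<Delta>\<close> and \<open>\<psi>\<close> of \<open>\<Gamma>\<close>.
  The realizations are part of the data, since carriers depend on them.\<close>

definition triangulates ::
    "('w \<Rightarrow> 'e::euclidean_space) \<Rightarrow> 'w set set \<Rightarrow> ('v \<Rightarrow> 'e) \<Rightarrow> 'v set set \<Rightarrow> bool" where
  "triangulates \<phi> \<Delta> \<psi> \<Gamma> \<longleftrightarrow>
     geom_realization \<phi> \<Delta> \<and> geom_realization \<psi> \<Gamma> \<and>
     geom_subdivides (realize \<phi> ` \<Delta>) (realize \<psi> ` \<Gamma>)"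

text \<open>The order underlying \<open>LEAST\<close> is inclusion of vertex sets.\<close>

definition carrier_face ::
    "('w \<Rightarrow> 'e::euclidean_space) \<Rightarrow> ('v \<Rightarrow> 'e) \<Rightarrow> 'v set set \<Rightarrow> 'w set \<Rightarrow> 'v set" where
  "carrier_face \<phi> \<psi> \<Gamma> G = (LEAST F. F \<in> \<Gamma> \<and> realize \<phi> G \<subseteq> realize \<psi> F)"

definition restrict_to ::
    "('w \<Rightarrow> 'e::euclidean_space) \<Rightarrow> 'w set set \<Rightarrow> ('v \<Rightarrow> 'e) \<Rightarrow> 'v set set \<Rightarrow> 'v set \<Rightarrow> 'w set set" where
  "restrict_to \<phi> \<Delta> \<psi> \<Gamma> F = {G \<in> \<Delta>. carrier_face \<phi> \<psi> \<Gamma> G \<subseteq> F}"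

text \<open>Faces are counted by cardinality: the \<open>i\<close>-element faces are those of dimension \<open>i - 1\<close>, and
  \<open>Max (card ` K)\<close> is the dimension plus one.\<close>

definition h_poly :: "'v set set \<Rightarrow> real poly" where
  "h_poly K =
     (let d = Max (card ` K) in
      \<Sum>i\<le>d. of_nat (card {F \<in> K. card F = i}) * [:0, 1:] ^ i * [:1, -1:] ^ (d - i))"

definition local_h_poly ::
    "('w \<Rightarrow> 'e::euclidean_space) \<Rightarrow> 'w set set \<Rightarrow> ('v \<Rightarrow> 'e) \<Rightarrow> 'v set \<Rightarrow> real poly" where
  "local_h_poly \<phi> \<Delta> \<psi> V =
     (\<Sum>F\<in>Pow V. (- 1) ^ (card V - card F) * h_poly (restrict_to \<phi> \<Delta> \<psi> (Pow V) F))"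

definition sd :: "'w set set \<Rightarrow> 'w set set set" where
  "sd \<Gamma> = chains (\<Gamma> - {{}})"

text \<open>Vertices of the barycentric subdivision are the nonempty faces of the original complex,
  placed at their barycenters.\<close>

definition barycenter :: "('w \<Rightarrow> 'e::euclidean_space) \<Rightarrow> 'w set \<Rightarrow> 'e" where
  "barycenter \<phi> F = (1 / real (card F)) *\<^sub>R (\<Sum>v\<in>F. \<phi> v)"

definition des :: "nat \<Rightarrow> (nat \<Rightarrow> nat) \<Rightarrow> nat" where
  "des n w = card {i \<in> {1..<n}. w i > w (i + 1)}"

definition eulerian_poly :: "nat \<Rightarrow> real poly" where
  "eulerian_poly n = (\<Sum>w | w permutes {1..n}. monom 1 (des n w))"

definition real_rooted :: "real poly \<Rightarrow> bool" where
  "real_rooted p \<longleftrightarrow>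
     p = 0 \<or> (\<forall>z::complex. poly (map_poly complex_of_real p) z = 0 \<longrightarrow> z \<in> \<real>)"

definition roots_desc :: "real poly \<Rightarrow> real list" where
  "roots_desc p = rev (sorted_list_of_multiset (proots p))"

text \<open>For nonzero \<open>f\<close> and \<open>g\<close> with roots \<open>\<alpha>\<^sub>1 \<ge> \<alpha>\<^sub>2 \<ge> \<dots>\<close> and \<open>\<beta>\<^sub>1 \<ge> \<beta>\<^sub>2 \<ge> \<dots>\<close> (with
  multiplicity), this says that \<open>\<beta>\<^sub>1 \<ge> \<alpha>\<^sub>1 \<ge> \<beta>\<^sub>2 \<ge> \<alpha>\<^sub>2 \<ge> \<dots>\<close> is a chain through all the roots, which
  forces \<open>deg g - deg f\<close> to be 0 or 1. A nonzero constant then interlaces precisely the nonzero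
  real-rooted polynomials of degree at most one.\<close>

definition interlaces :: "real poly \<Rightarrow> real poly \<Rightarrow> bool" (infix \<open>\<preceq>\<close> 50) where
  "f \<preceq> g \<longleftrightarrow>
     real_rooted f \<and> real_rooted g \<and>
     (f = 0 \<or> g = 0 \<or>
      (let \<alpha> = roots_desc f; \<beta> = roots_desc g in
        (length \<beta> = length \<alpha> \<or> length \<beta> = length \<alpha> + 1) \<and>
        (\<forall>i < length \<alpha>. \<alpha> ! i \<le> \<beta> ! i) \<and>
        (\<forall>i. i + 1 < length \<beta> \<longrightarrow> \<beta> ! (i + 1) \<le> \<alpha> ! i)))"

end

theory Submission
  imports Defs "HOL-Combinatorics.Multiset_Permutations"
begin

text \<open>Let \<open>eul n k\<close> be the descent enumerator of the permutations of \<open>n + 1\<close> letters that start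
  with the letter \<open>k + 1\<close>, so that the Eulerian polynomial is \<open>eul n 0\<close>. Sorting the chains of faces
  by their largest element shows that the local \<open>h\<close>-polynomial of \<open>sd \<Gamma>\<close> is the sum of
  \<open>(- x)^(n - c) (1 - x)^(c - g) eul g g\<close> over the faces of \<open>\<Gamma>\<close>, \<open>g\<close> and \<open>c\<close> being the sizes
  of the face and of its carrier. Expanding \<open>(- x)^(n - c) (1 - x)^c\<close> over the subsets \<open>S\<close> of the
  carriers turns \<open>(1 - x)^n\<close> times this polynomial into the sum over \<open>S \<subseteq> V\<close> of
  \<open>(- x)^(n - |S|)\<close> times the sum of \<open>(1 - x)^(n - g) eul g g\<close> over the faces whose carrier
  contains \<open>S\<close>.

  Now view \<open>\<Gamma>\<close> as a subdivision of the nonnegative orthant into simplicial cones and choose a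
  generic vector \<open>\<xi>\<close> that is negative exactly on \<open>S\<close>. If \<open>R \<sigma>\<close> consists of the vertices of the
  facet \<open>\<sigma>\<close> at which the coordinate of \<open>\<xi>\<close> is negative, then the faces whose carrier contains
  \<open>S\<close> are partitioned by the intervals \<open>[R \<sigma>, \<sigma>]\<close>, and the inner sum becomes the sum of the
  polynomials \<open>eul n |R \<sigma>|\<close> over the facets.

  All roots of \<open>eul n 0\<close> are simple and negative, and at the \<open>i\<close>-th largest one every \<open>eul n j\<close>
  with \<open>0 < j < n\<close> has the sign \<open>(- 1)^i\<close>, while \<open>eul n 0\<close> and \<open>eul n n\<close> vanish. Hence the
  local \<open>h\<close>-polynomial has this sign, too; as it vanishes at 0 and has degree less than \<open>n\<close>, its
  roots are 0 and one between any two neighbouring roots of \<open>eul n 0\<close>.\<close>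


section \<open>Eulerian polynomials refined by the first letter\<close>

text \<open>\<open>eul n k\<close> enumerates by descents the permutations of \<open>n + 1\<close> letters whose first letter
  is the \<open>(k + 1)\<close>-st smallest one; the recursion deletes the first letter.\<close>

primrec eul :: "nat \<Rightarrow> nat \<Rightarrow> real poly" where
  "eul 0 k = 1"
| "eul (Suc n) k = [:0, 1:] * (\<Sum>j<k. eul n j) + (\<Sum>j\<in>{k..n}. eul n j)"

text \<open>Passing from \<open>k\<close> to \<open>Suc k\<close> changes one summand of the
  recursion: the second letter of rank \<open>k\<close> turns from an ascent into a descent, so
  \<open>eul n k\<close> acquires the factor x.\<close>

lemma eul_diff:
  assumes "k \<le> n"
  shows "eul (Suc n) k = eul (Suc n) (Suc k) + [:1, -1:] * eul n k"
proof -
  have *: "(\<Sum>j\<in>{k..n}. eul n j) = eul n k + (\<Sum>j\<in>{Suc k..n}. eul n j)"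
    using assms by (rule sum.atLeast_Suc_atMost)
  have "[:1, -1:] = 1 - ([:0, 1:] :: real poly)" by (simp add: one_pCons)
  then show ?thesis unfolding eul.simps * by (simp add: algebra_simps)
qed

lemma eul_Suc_0: "eul (Suc n) 0 = (\<Sum>j\<le>n. eul n j)"
  by (simp add: atMost_atLeast0)

text \<open>A largest first letter is followed by a descent and a smallest one by an ascent,
  whatever the remaining word is.\<close>

lemma eul_last: "eul (Suc n) (Suc n) = [:0, 1:] * eul (Suc n) 0"
  by (simp add: atMost_atLeast0 lessThan_Suc_atMost)

text \<open>Fix \<open>v\<close> in \<open>B - A\<close>. The sets \<open>G\<close> containing
  \<open>v\<close> and those avoiding it contribute the two terms on the right of
  \<open>eul_diff\<close>.\<close>

lemma eul_interval:
  assumes "finite B" "A \<subseteq> B"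
  shows "(\<Sum>G | A \<subseteq> G \<and> G \<subseteq> B. [:1, -1:] ^ (card B - card G) * eul (card G) (card G))
         = eul (card B) (card A)"
  using assms
proof (induction "card (B - A)" arbitrary: A B)
  case 0
  then have "A = B" by auto
  then have "{G. A \<subseteq> G \<and> G \<subseteq> B} = {B}" by auto
  then show ?case using \<open>A = B\<close> by simp
next
  case (Suc m)
  then obtain v where v: "v \<in> B" "v \<notin> A"
    by (metis Diff_eq_empty_iff card.empty nat.distinct(1) subsetI)
  let ?f = "\<lambda>N G. [:1, -1:] ^ (N - card G) * eul (card G) (card G)"
  have fA: "finite A" using Suc.prems finite_subset by blast
  have cB: "card B = Suc (card (B - {v}))" using v Suc.prems by (metis card_Suc_Diff1)
  have split: "{G. A \<subseteq> G \<and> G \<subseteq> B} = {G. insert v A \<subseteq> G \<and> G \<subseteq> B} \<union> {G. A \<subseteq> G \<and> G \<subseteq> B - {v}}"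
    using v by auto
  have "(\<Sum>G | A \<subseteq> G \<and> G \<subseteq> B. ?f (card B) G)
      = (\<Sum>G | insert v A \<subseteq> G \<and> G \<subseteq> B. ?f (card B) G) + (\<Sum>G | A \<subseteq> G \<and> G \<subseteq> B - {v}. ?f (card B) G)"
    unfolding split by (rule sum.union_disjoint) (use Suc.prems in auto)
  also have "(\<Sum>G | insert v A \<subseteq> G \<and> G \<subseteq> B. ?f (card B) G) = eul (card B) (Suc (card A))"
  proof -
    have "B - insert v A = B - A - {v}" by auto
    then have "m = card (B - insert v A)" using Suc.hyps(2) v by simp
    then show ?thesis using Suc.hyps(1)[of B "insert v A"] Suc.prems v fA by simp
  qed
  also have "(\<Sum>G | A \<subseteq> G \<and> G \<subseteq> B - {v}. ?f (card B) G)
     = (\<Sum>G | A \<subseteq> G \<and> G \<subseteq> B - {v}. [:1, -1:] * ?f (card (B - {v})) G)"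
  proof (rule sum.cong[OF refl], clarify)
    fix G assume "A \<subseteq> G" "G \<subseteq> B - {v}"
    then have "card G \<le> card (B - {v})" using Suc.prems by (simp add: card_mono)
    then show "?f (card B) G = [:1, -1:] * ?f (card (B - {v})) G"
      unfolding cB by (simp only: Suc_diff_le power_Suc mult.assoc)
  qed
  also have "\<dots> = [:1, -1:] * eul (card (B - {v})) (card A)"
  proof -
    have "B - {v} - A = B - A - {v}" by auto
    then have "m = card (B - {v} - A)" using Suc.hyps(2) v by simp
    moreover have "A \<subseteq> B - {v}" using v Suc.prems by auto
    ultimately have "(\<Sum>G | A \<subseteq> G \<and> G \<subseteq> B - {v}. ?f (card (B - {v})) G)
        = eul (card (B - {v})) (card A)"
      using Suc.hyps(1)[of "B - {v}" A] Suc.prems by blast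
    then show ?thesis by (simp only: flip: sum_distrib_left)
  qed
  also have "eul (card B) (Suc (card A)) + \<dots> = eul (card B) (card A)"
  proof -
    have "card A \<le> card (B - {v})" using Suc.prems v by (intro card_mono) auto
    then show ?thesis unfolding cB by (rule eul_diff[symmetric])
  qed
  finally show ?case .
qed

text \<open>This is the recursion that \<open>sum_chains_with_top\<close> will match. In
  \<open>eul_interval\<close> with \<open>A = {}\<close> the set \<open>G = B\<close> contributes x
  times \<open>eul (card B) 0\<close>, by \<open>eul_last\<close>; the other sets contribute (1 - x)
  times the sum, and 1 - x cancels.\<close>

lemma eul_proper_subsets:
  assumes "finite B" "B \<noteq> {}"
  shows "eul (card B) (card B)
    = [:0, 1:] * (\<Sum>G | G \<subset> B. [:1, -1:] ^ (card B - 1 - card G) * eul (card G) (card G))"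
    (is "_ = _ * ?S")
proof -
  obtain m where m: "card B = Suc m" using assms by (metis card_gt_0_iff gr0_implies_Suc)
  have sp: "{G. {} \<subseteq> G \<and> G \<subseteq> B} = insert B {G. G \<subset> B}" by auto
  have fin: "finite {G. G \<subset> B}" using assms by (auto intro: finite_subset[of _ "Pow B"])
  have "eul (card B) 0 = (\<Sum>G | {} \<subseteq> G \<and> G \<subseteq> B. [:1, -1:] ^ (card B - card G) * eul (card G) (card G))"
    using eul_interval[of B "{}"] assms by simp
  also have "\<dots> = eul (card B) (card B)
      + (\<Sum>G | G \<subset> B. [:1, -1:] ^ (card B - card G) * eul (card G) (card G))"
    unfolding sp using fin by simp
  also have "(\<Sum>G | G \<subset> B. [:1, -1:] ^ (card B - card G) * eul (card G) (card G))
     = (\<Sum>G | G \<subset> B. [:1, -1:] * ([:1, -1:] ^ (card B - 1 - card G) * eul (card G) (card G)))"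
  proof (rule sum.cong[OF refl])
    fix G assume "G \<in> {G. G \<subset> B}"
    then have "card G < card B" using assms by (simp add: psubset_card_mono)
    then have "card B - card G = Suc (card B - 1 - card G)" by simp
    then show "[:1, -1:] ^ (card B - card G) * eul (card G) (card G)
      = [:1, -1:] * ([:1, -1:] ^ (card B - 1 - card G) * eul (card G) (card G))"
      by (simp only: power_Suc mult.assoc)
  qed
  also have "\<dots> = [:1, -1:] * ?S" by (simp only: sum_distrib_left)
  finally have "eul (card B) 0 = [:0, 1:] * eul (card B) 0 + [:1, -1:] * ?S"
    unfolding m eul_last .
  moreover have "[:1, -1:] * eul (card B) 0 = eul (card B) 0 - [:0, 1:] * eul (card B) 0"
    by simp
  ultimately have "[:1, -1:] * eul (card B) 0 = [:1, -1:] * ?S" by (simp only: add_diff_cancel_left')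
  then have "eul (card B) 0 = ?S" by (subst (asm) mult_cancel_left) auto
  then show ?thesis unfolding m eul_last by simp
qed

text \<open>Only the decreasing word on n + 1 letters has n descents, and it starts with the largest
  letter; hence the drop of the degree for \<open>k < n\<close>.\<close>

lemma degree_eul: "k \<le> n \<Longrightarrow> degree (eul n k) \<le> n \<and> (k < n \<longrightarrow> degree (eul n k) < n)"
proof (induction n arbitrary: k)
  case (Suc n)
  have x: "degree ([:0, 1:] * p) \<le> Suc (degree p)" for p :: "real poly"
    by (simp add: degree_pCons_eq_if)
  have 2: "degree (\<Sum>j\<in>{k..n}. eul n j) \<le> n"
    by (rule degree_sum_le) (use Suc.IH in auto)
  show ?case
  proof (cases "k \<le> n")
    case True
    have "degree ([:0, 1:] * (\<Sum>j<k. eul n j)) \<le> n"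
    proof (cases "k = 0")
      case False
      have "degree (\<Sum>j<k. eul n j) \<le> n - 1"
      proof (rule degree_sum_le)
        fix j assume "j \<in> {..<k}"
        then show "degree (eul n j) \<le> n - 1" using Suc.IH[of j] True by auto
      qed simp
      then show ?thesis using x[of "\<Sum>j<k. eul n j"] False True by linarith
    qed auto
    then have "degree (eul (Suc n) k) \<le> n" unfolding eul.simps using 2 by (rule degree_add_le)
    then show ?thesis by simp
  next
    case False
    with Suc.prems have k: "k = Suc n" by simp
    have "degree (\<Sum>j<k. eul n j) \<le> n"
      by (rule degree_sum_le) (use Suc.IH k in auto)
    then have "degree ([:0, 1:] * (\<Sum>j<k. eul n j)) \<le> Suc n" using x[of "\<Sum>j<k. eul n j"] by linarith
    then have "degree (eul (Suc n) k) \<le> Suc n" unfolding eul.simps using 2 by (intro degree_add_le) auto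
    then show ?thesis using k by simp
  qed
qed simp

text \<open>Among the summands of \<open>eul_Suc_0\<close> only the last reaches the top degree, and
  there \<open>eul_last\<close> leads back to the previous case.\<close>

lemma coeff_eul_0: "coeff (eul (Suc n) 0) n = 1"
proof (induction n)
  case (Suc n)
  have "coeff (eul (Suc (Suc n)) 0) (Suc n) = (\<Sum>j\<le>Suc n. coeff (eul (Suc n) j) (Suc n))"
    unfolding eul_Suc_0[of "Suc n"] by (simp add: coeff_sum)
  also have "\<dots> = coeff (eul (Suc n) (Suc n)) (Suc n) + (\<Sum>j\<le>n. coeff (eul (Suc n) j) (Suc n))"
    by simp
  also have "(\<Sum>j\<le>n. coeff (eul (Suc n) j) (Suc n)) = 0"
  proof (rule sum.neutral, rule ballI)
    fix j assume "j \<in> {..n}"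
    then show "coeff (eul (Suc n) j) (Suc n) = 0" using degree_eul[of j "Suc n"] by (intro coeff_eq_0) auto
  qed
  also have "coeff (eul (Suc n) (Suc n)) (Suc n) = 1"
    unfolding eul_last using Suc.IH by simp
  finally show ?case by simp
qed simp

text \<open>Only the increasing word has no descent, and it starts with the smallest letter. The
  disjunct \<open>n = 0\<close> accounts for \<open>eul 0 k = 1\<close> at every
  \<open>k\<close>.\<close>

lemma poly_eul_0: "poly (eul n k) 0 = (if k = 0 \<or> n = 0 then 1 else 0)"
proof (induction n arbitrary: k)
  case (Suc n)
  have "poly (eul (Suc n) k) 0 = (\<Sum>j\<in>{k..n}. if j = 0 \<or> n = 0 then 1 else 0)"
    by (simp add: poly_sum Suc.IH)
  also have "\<dots> = (if k = 0 then 1 else 0)"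
    by (cases "n = 0") (auto simp: sum.If_cases sum.delta)
  finally show ?case by simp
qed simp


section \<open>Descents and the first letter\<close>

fun desl :: "'a::linorder list \<Rightarrow> nat" where
  "desl (a # b # xs) = (if b < a then 1 else 0) + desl (b # xs)"
| "desl _ = 0"

lemma desl_eq: "desl xs = card {i. Suc i < length xs \<and> xs ! i > xs ! Suc i}"
proof (induction xs rule: desl.induct)
  case (1 a b xs)
  let ?P = "\<lambda>ys i. Suc i < length ys \<and> ys ! i > ys ! Suc i"
  have fin: "finite {i. ?P (b # xs) i}" by (rule finite_subset[of _ "{..length xs}"]) auto
  have "{i. ?P (a # b # xs) i} = (if b < a then {0} else {}) \<union> Suc ` {i. ?P (b # xs) i}"
  proof (intro set_eqI)
    fix i show "(i \<in> {i. ?P (a # b # xs) i}) \<longleftrightarrow> (i \<in> (if b < a then {0} else {}) \<union> Suc ` {i. ?P (b # xs) i})"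
      by (cases i) auto
  qed
  moreover have "card ((if b < a then {0} else {}) \<union> Suc ` {i. ?P (b # xs) i})
     = card (if b < a then {0::nat} else {}) + card (Suc ` {i. ?P (b # xs) i})"
    by (rule card_Un_disjoint) (use fin in auto)
  ultimately show ?case using 1 by (simp add: card_image)
qed auto

definition rank_in :: "'a::linorder set \<Rightarrow> 'a \<Rightarrow> nat" where
  "rank_in S a = card {b \<in> S. b < a}"

lemma bij_betw_rank_in:
  assumes "finite S"
  shows "bij_betw (rank_in S) S {..<card S}"
proof -
  have less: "rank_in S a < rank_in S b" if "a \<in> S" "a < b" for a b
    unfolding rank_in_def using assms that by (intro psubset_card_mono) auto
  have inj: "inj_on (rank_in S) S"
    by (rule linorder_inj_onI) (use less in \<open>force+\<close>)
  have sub: "rank_in S ` S \<subseteq> {..<card S}"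
    unfolding rank_in_def using assms by (auto intro!: psubset_card_mono)
  have "rank_in S ` S = {..<card S}"
    by (rule card_subset_eq) (use sub inj in \<open>auto simp: card_image\<close>)
  with inj show ?thesis by (simp add: bij_betw_def)
qed

lemma sum_rank_in:
  assumes "finite S"
  shows "(\<Sum>a\<in>S. f (rank_in S a)) = (\<Sum>j<card S. f j)"
  using sum.reindex_bij_betw[OF bij_betw_rank_in[OF assms], of f] .

lemma sum_permutations_of_set_Cons:
  fixes f :: "'a list \<Rightarrow> 'b::comm_monoid_add"
  assumes "finite S" "S \<noteq> {}"
  shows "(\<Sum>xs\<in>permutations_of_set S. f xs) = (\<Sum>a\<in>S. \<Sum>xs\<in>permutations_of_set (S - {a}). f (a # xs))"
proof -
  have "(\<Sum>xs\<in>permutations_of_set S. f xs) = (\<Sum>a\<in>S. \<Sum>xs\<in>(#) a ` permutations_of_set (S - {a}). f xs)"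
    unfolding permutations_of_set_nonempty[OF assms(2)]
    by (rule sum.UNION_disjoint) (use assms in auto)
  then show ?thesis by (simp add: sum.reindex)
qed

text \<open>The letters form an arbitrary finite set because the induction deletes the first one.
  Deleting \<open>a\<close> does not change how many letters lie below it, so \<open>b < a\<close>
  can be read off from the rank of \<open>b\<close> in the smaller set; this reproduces the
  recursion of \<open>eul\<close>.\<close>

lemma sum_desl_first_letter:
  assumes "finite S" "a \<in> S"
  shows "(\<Sum>xs\<in>permutations_of_set (S - {a}). monom 1 (desl (a # xs))) = eul (card S - 1) (rank_in S a)"
  using assms
proof (induction "card S - 1" arbitrary: S a)
  case 0
  have "card S > 0" using 0 by (auto simp: card_gt_0_iff)
  with 0 have "card S = 1" by linarith
  then have "S = {a}" using 0 by (auto simp: card_1_singleton_iff)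
  then show ?case by (simp add: monom_0 one_pCons)
next
  case (Suc n)
  let ?T = "S - {a}"
  have cT: "card ?T = Suc n" using Suc by simp
  have T: "finite ?T" using Suc.prems by simp
  have T0: "?T \<noteq> {}" using cT by (metis card.empty nat.distinct(1))
  have monom: "monom 1 (desl (a # b # xs)) = (if b < a then [:0, 1:] else 1) * monom (1::real) (desl (b # xs))"
    for b xs by (simp add: monom_Suc)
  have rank: "rank_in S a = card {b \<in> ?T. b < a}" unfolding rank_in_def by (rule arg_cong[of _ _ card]) auto
  have less_iff: "b < a \<longleftrightarrow> rank_in ?T b < rank_in S a" if "b \<in> ?T" for b
  proof
    assume "b < a"
    then show "rank_in ?T b < rank_in S a"
      unfolding rank unfolding rank_in_def using Suc.prems that by (intro psubset_card_mono) auto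
  next
    assume *: "rank_in ?T b < rank_in S a"
    show "b < a"
    proof (rule ccontr)
      assume "\<not> b < a"
      then have "rank_in S a \<le> rank_in ?T b"
        unfolding rank unfolding rank_in_def using Suc.prems that by (intro card_mono) auto
      with * show False by simp
    qed
  qed
  have rank_le: "rank_in S a \<le> Suc n"
    unfolding rank using card_mono[of ?T "{b \<in> ?T. b < a}"] T cT by auto
  have "(\<Sum>xs\<in>permutations_of_set ?T. monom 1 (desl (a # xs)))
     = (\<Sum>b\<in>?T. \<Sum>xs\<in>permutations_of_set (?T - {b}). monom (1::real) (desl (a # b # xs)))"
    by (rule sum_permutations_of_set_Cons[OF T T0])
  also have "\<dots> = (\<Sum>b\<in>?T. (if b < a then [:0, 1:] else 1) *
      (\<Sum>xs\<in>permutations_of_set (?T - {b}). monom (1::real) (desl (b # xs))))"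
    by (simp only: monom sum_distrib_left)
  also have "\<dots> = (\<Sum>b\<in>?T. (if rank_in ?T b < rank_in S a then [:0, 1:] else 1) * eul n (rank_in ?T b))"
    by (rule sum.cong[OF refl]) (use Suc.hyps(1)[of ?T] cT T less_iff in simp)
  also have "\<dots> = (\<Sum>j<Suc n. (if j < rank_in S a then [:0, 1:] else 1) * eul n j)"
    using sum_rank_in[OF T, of "\<lambda>j. (if j < rank_in S a then [:0, 1:] else 1) * eul n j"] cT by simp
  also have "{..<Suc n} = {..<rank_in S a} \<union> {rank_in S a..n}" using rank_le by auto
  also have "(\<Sum>j\<in>{..<rank_in S a} \<union> {rank_in S a..n}. (if j < rank_in S a then [:0, 1:] else 1) * eul n j)
     = (\<Sum>j<rank_in S a. [:0, 1:] * eul n j) + (\<Sum>j\<in>{rank_in S a..n}. eul n j)"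
    by (subst sum.union_disjoint) (auto intro!: arg_cong2[of _ _ _ _ "(+)"] sum.cong)
  also have "\<dots> = eul (Suc n) (rank_in S a)" by (simp only: eul.simps sum_distrib_left)
  finally show ?case using Suc.hyps(2) by simp
qed

lemma bij_betw_permutes_lists:
  "bij_betw (\<lambda>w. map w [1..<Suc n]) {w. w permutes {1..n}} (permutations_of_set {1..n})"
  unfolding bij_betw_def
proof
  show inj: "inj_on (\<lambda>w. map w [1..<Suc n]) {w. w permutes {1..n}}"
  proof (rule inj_onI, rule ext)
    fix w w' x assume w: "w \<in> {w. w permutes {1..n}}" "w' \<in> {w. w permutes {1..n}}"
      and eq: "map w [1..<Suc n] = map w' [1..<Suc n]"
    show "w x = w' x"
      by (cases "x \<in> {1..n}") (use w eq in \<open>auto simp: permutes_def map_eq_conv\<close>)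
  qed
  show "(\<lambda>w. map w [1..<Suc n]) ` {w. w permutes {1..n}} = permutations_of_set {1..n}"
  proof (rule card_subset_eq)
    have "w ` {1..<Suc n} = {1..n}" if "w permutes {1..n}" for w
      using permutes_image[OF that] by (simp add: atLeastLessThanSuc_atLeastAtMost)
    then show "(\<lambda>w. map w [1..<Suc n]) ` {w. w permutes {1..n}} \<subseteq> permutations_of_set {1..n}"
      by (auto simp del: upt_Suc simp: permutations_of_set_def distinct_map intro: permutes_inj_on)
    show "card ((\<lambda>w. map w [1..<Suc n]) ` {w. w permutes {1..n}}) = card (permutations_of_set {1..n})"
      using inj by (simp add: card_image card_permutations[OF refl] del: upt_Suc)
  qed simp
qed

text \<open>Summing over the first letter gives the sum of all \<open>eul m j\<close> with
  \<open>n = Suc m\<close>, which is \<open>eul n 0\<close>: a new smallest letter in front creates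
  no descent.\<close>

lemma eulerian_poly_eq: "eulerian_poly n = eul n 0"
proof -
  have des: "desl (map w [1..<Suc n]) = des n w" for w :: "nat \<Rightarrow> nat"
  proof -
    have "{i \<in> {1..<n}. w i > w (i + 1)}
        = Suc ` {i. Suc i < length (map w [1..<Suc n]) \<and> map w [1..<Suc n] ! i > map w [1..<Suc n] ! Suc i}"
      (is "?A = Suc ` ?B")
    proof (intro set_eqI iffI)
      fix i assume "i \<in> ?A"
      then show "i \<in> Suc ` ?B" by (intro image_eqI[of _ _ "i - 1"]) (auto simp del: upt_Suc)
    qed (auto simp del: upt_Suc)
    then show ?thesis unfolding desl_eq des_def by (simp add: card_image)
  qed
  have "eulerian_poly n = (\<Sum>xs\<in>permutations_of_set {1..n}. monom 1 (desl xs))"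
    unfolding eulerian_poly_def des[symmetric]
    by (rule sum.reindex_bij_betw[OF bij_betw_permutes_lists])
  also have "\<dots> = eul n 0"
  proof (cases n)
    case 0
    then show ?thesis by (simp add: monom_0 one_pCons)
  next
    case (Suc m)
    have "(\<Sum>xs\<in>permutations_of_set {1..n}. monom 1 (desl xs)) = (\<Sum>a\<in>{1..n}.
        \<Sum>xs\<in>permutations_of_set ({1..n} - {a}). monom (1::real) (desl (a # xs)))"
      by (rule sum_permutations_of_set_Cons) (use Suc in auto)
    also have "\<dots> = (\<Sum>a\<in>{1..n}. eul (card {1..n} - 1) (rank_in {1..n} a))"
      by (rule sum.cong[OF refl], rule sum_desl_first_letter) auto
    also have "\<dots> = (\<Sum>a\<in>{1..n}. eul m (rank_in {1..n} a))" unfolding Suc by simp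
    also have "\<dots> = (\<Sum>j<n. eul m j)" using sum_rank_in[of "{1..n}" "eul m"] by simp
    also have "\<dots> = eul n 0" unfolding Suc eul_Suc_0 lessThan_Suc_atMost ..
    finally show ?thesis .
  qed
  finally show ?thesis .
qed

declare eul.simps(2) [simp del]

section \<open>Signs of the refined Eulerian polynomials\<close>

text \<open>At a negative argument the values \<open>eul n 0, \<dots>, eul n n\<close> change sign at most once.\<close>

definition one_sign_change :: "nat \<Rightarrow> (nat \<Rightarrow> real) \<Rightarrow> bool" where
  "one_sign_change n s \<longleftrightarrow>
     (s 0 > 0 \<longrightarrow> (\<forall>i j. i \<le> j \<and> j \<le> n \<and> s i \<le> 0 \<longrightarrow> s j \<le> 0)) \<and>
     (s 0 < 0 \<longrightarrow> (\<forall>i j. i \<le> j \<and> j \<le> n \<and> s i \<ge> 0 \<longrightarrow> s j \<ge> 0)) \<and>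
     (s 0 = 0 \<longrightarrow> n \<ge> 2 \<and> ((\<forall>k. 1 \<le> k \<and> k < n \<longrightarrow> s k > 0) \<or> (\<forall>k. 1 \<le> k \<and> k < n \<longrightarrow> s k < 0)))"

text \<open>\<open>a\<close> and \<open>b\<close> stand for the values of \<open>eul n\<close> and
  \<open>eul (Suc n)\<close> at \<open>x\<close>, and \<open>c\<close> for 1 - x: \<open>b\<close>
  falls where \<open>a\<close> is positive and rises where \<open>a\<close> is negative. The
  abstract form also applies to the negated sequences.\<close>

locale partial_sums =
  fixes n :: nat and a b :: "nat \<Rightarrow> real" and c x :: real
  assumes diff: "\<And>k. k \<le> n \<Longrightarrow> b k - b (Suc k) = c * a k"
    and c: "c > 0" and x: "x < 0"
    and bn: "b (Suc n) = x * b 0"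
begin

lemma mono_up:
  assumes "i \<le> j" "j \<le> Suc n" "\<And>k. i \<le> k \<Longrightarrow> k < j \<Longrightarrow> a k \<le> 0"
  shows "b i \<le> b j"
  using assms
proof (induction j rule: dec_induct)
  case (step m)
  then have "a m \<le> 0" by simp
  then have "c * a m \<le> 0" using c by (simp add: mult_le_0_iff)
  then show ?case using diff[of m] step by fastforce
qed simp

lemma mono_down:
  assumes "i \<le> j" "j \<le> Suc n" "\<And>k. i \<le> k \<Longrightarrow> k < j \<Longrightarrow> a k \<ge> 0"
  shows "b j \<le> b i"
  using assms
proof (induction j rule: dec_induct)
  case (step m)
  then have "a m \<ge> 0" by simp
  then have "c * a m \<ge> 0" using c by simp
  then show ?case using diff[of m] step by fastforce
qed simp

text \<open>In the first case \<open>b\<close> falls and then rises: a rise back above 0 would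
  persist up to \<open>b (Suc n) = x * b 0\<close>, which is negative. In the second case
  \<open>b\<close> rises and then falls: having fallen to 0 or below, it never rises again.\<close>

lemma nonpos_stays_nonpos:
  assumes a: "(\<forall>i j. i \<le> j \<and> j \<le> n \<and> a i < 0 \<longrightarrow> a j \<le> 0) \<or> (\<forall>i j. i \<le> j \<and> j \<le> n \<and> a i > 0 \<longrightarrow> a j \<ge> 0)"
    and b0: "b 0 > 0" and ij: "i \<le> j" "j \<le> Suc n" and bi: "b i \<le> 0"
  shows "b j \<le> 0"
  using a
proof
  assume a: "\<forall>i j. i \<le> j \<and> j \<le> n \<and> a i < 0 \<longrightarrow> a j \<le> 0"
  show ?thesis
  proof (rule ccontr)
    assume bj: "\<not> b j \<le> 0"
    obtain k where k: "i \<le> k" "k < j" "a k < 0"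
      using mono_down[OF ij] bi bj by force
    have "a l \<le> 0" if "j \<le> l" "l < Suc n" for l
      using a[rule_format, of k l] k that by simp
    then have "b j \<le> b (Suc n)" using mono_up[of j "Suc n"] ij by simp
    also have "\<dots> < 0" using bn b0 x by (simp add: mult_less_0_iff)
    finally show False using bj by simp
  qed
next
  assume a: "\<forall>i j. i \<le> j \<and> j \<le> n \<and> a i > 0 \<longrightarrow> a j \<ge> 0"
  obtain k where k: "k < i" "a k > 0"
    using mono_up[of 0 i] bi b0 ij by force
  have "a l \<ge> 0" if "i \<le> l" "l < j" for l
    using a[rule_format, of k l] k ij that by simp
  then have "b j \<le> b i" using mono_down[OF ij] by simp
  with bi show ?thesis by simp
qed

text \<open>Here \<open>b\<close> starts and ends at 0, first falling and then rising. On the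
  falling part it stays below \<open>b 1\<close>, on the rising part below \<open>b n\<close>, and
  both are negative.\<close>

lemma inner_neg:
  assumes a0: "a 0 > 0" and a: "\<forall>i j. i \<le> j \<and> j \<le> n \<and> a i \<le> 0 \<longrightarrow> a j \<le> 0"
    and an: "a n < 0" and b0: "b 0 = 0" and k: "1 \<le> k" "k \<le> n"
  shows "b k < 0"
proof (cases "\<forall>i<k. a i > 0")
  case True
  have "b k \<le> b 1" by (rule mono_down) (use True k in \<open>auto intro: less_imp_le\<close>)
  also have "b 1 < 0" using diff[of 0] mult_pos_pos[OF c a0] b0 by simp
  finally show ?thesis .
next
  case False
  then obtain i where i: "i < k" "a i \<le> 0" by force
  have "a l \<le> 0" if "k \<le> l" "l < n" for l
    using a[rule_format, of i l] i that by simp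
  then have "b k \<le> b n" using mono_up[of k n] k by simp
  also have "b n = c * a n" using diff[of n] bn b0 by simp
  also have "\<dots> < 0" using c an by (simp add: mult_less_0_iff)
  finally show ?thesis .
qed

end

lemma one_sign_change_eul:
  assumes x: "x < 0"
  shows "one_sign_change n (\<lambda>k. poly (eul n k) x)"
proof (induction n)
  case 0
  then show ?case by (simp add: one_sign_change_def)
next
  case (Suc n)
  define a where "a = (\<lambda>k. poly (eul n k) x)"
  define b where "b = (\<lambda>k. poly (eul (Suc n) k) x)"
  have IH: "one_sign_change n a" using Suc by (simp add: a_def)
  have diff: "b k - b (Suc k) = (1 - x) * a k" if "k \<le> n" for k
    unfolding b_def eul_diff[OF that] by (simp add: a_def algebra_simps)
  have bn: "b (Suc n) = x * b 0" unfolding b_def eul_last by simp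
  interpret pos: partial_sums n a b "1 - x" x
    by unfold_locales (use diff bn x in auto)
  \<comment> \<open>The copy with reversed signs serves the cases in which \<open>b 0\<close> or,
    for \<open>b 0 = 0\<close>, the value \<open>a 0\<close> is negative.\<close>
  interpret neg: partial_sums n "\<lambda>k. - a k" "\<lambda>k. - b k" "1 - x" x
    by unfold_locales (use diff bn x in \<open>auto simp: algebra_simps\<close>)
  have an: "a n = x * a 0" if "n \<ge> 1"
    using that unfolding a_def by (cases n) (simp_all only: eul_last poly_mult, simp)
  have ab: "b 0 = (\<Sum>k\<le>n. a k)" unfolding b_def a_def eul_Suc_0 by (simp add: poly_sum)
  have ends: "a k = 0" if "a 0 = 0" "\<not> (1 \<le> k \<and> k < n)" "k \<le> n" for k
    using that an by (cases "k = 0"; cases "k = n") auto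
  \<comment> \<open>If \<open>a 0 = 0\<close>, then both end values vanish and the inner ones share
    one sign, so either disjunct can be met without any sign change.\<close>
  have U: "(\<forall>i j. i \<le> j \<and> j \<le> n \<and> a i < 0 \<longrightarrow> a j \<le> 0) \<or> (\<forall>i j. i \<le> j \<and> j \<le> n \<and> a i > 0 \<longrightarrow> a j \<ge> 0)"
  proof (cases "a 0" "0::real" rule: linorder_cases)
    case less
    then show ?thesis using IH unfolding one_sign_change_def by (meson less_imp_le)
  next
    case greater
    then show ?thesis using IH unfolding one_sign_change_def by (meson less_imp_le)
  next
    case equal
    with IH consider "\<forall>k. 1 \<le> k \<and> k < n \<longrightarrow> a k > 0" | "\<forall>k. 1 \<le> k \<and> k < n \<longrightarrow> a k < 0"
      unfolding one_sign_change_def by blast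
    then show ?thesis
    proof cases
      case 1
      then have "a j \<ge> 0" if "j \<le> n" for j
        using ends[OF equal, of j] that by (cases "1 \<le> j \<and> j < n") (auto intro: less_imp_le)
      then show ?thesis by blast
    next
      case 2
      then have "a j \<le> 0" if "j \<le> n" for j
        using ends[OF equal, of j] that by (cases "1 \<le> j \<and> j < n") (auto intro: less_imp_le)
      then show ?thesis by blast
    qed
  qed
  have 1: "b j \<le> 0" if "b 0 > 0" "i \<le> j" "j \<le> Suc n" "b i \<le> 0" for i j
    by (rule pos.nonpos_stays_nonpos[OF U]) (use that in auto)
  have 2: "b j \<ge> 0" if "b 0 < 0" "i \<le> j" "j \<le> Suc n" "b i \<ge> 0" for i j
    using neg.nonpos_stays_nonpos[of i j] U that by auto
  have 3: "n \<ge> 1 \<and> ((\<forall>k. 1 \<le> k \<and> k \<le> n \<longrightarrow> b k > 0) \<or> (\<forall>k. 1 \<le> k \<and> k \<le> n \<longrightarrow> b k < 0))" if b0: "b 0 = 0"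
  proof -
    have n: "n \<ge> 1"
    proof (rule ccontr)
      assume "\<not> n \<ge> 1"
      then have n0: "n = 0" by simp
      then have "a 0 = 0" using ab b0 by simp
      then show False using IH n0 by (simp add: one_sign_change_def)
    qed
    \<comment> \<open>Otherwise \<open>b 0\<close> would be the sum of the inner values of
      \<open>a\<close>, which exist because of \<open>n \<ge> 2\<close> and have one strict
      sign.\<close>
    have a0: "a 0 \<noteq> 0"
    proof
      assume a0: "a 0 = 0"
      with IH have n2: "n \<ge> 2" and
        *: "(\<forall>k. 1 \<le> k \<and> k < n \<longrightarrow> a k > 0) \<or> (\<forall>k. 1 \<le> k \<and> k < n \<longrightarrow> a k < 0)"
        unfolding one_sign_change_def by blast+
      have "(\<Sum>k\<le>n. a k) = (\<Sum>k\<in>{1..<n}. a k)"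
        by (rule sum.mono_neutral_right) (use ends[OF a0] in auto)
      then have z: "(\<Sum>k\<in>{1..<n}. a k) = 0" using ab b0 by simp
      from * show False
      proof
        assume "\<forall>k. 1 \<le> k \<and> k < n \<longrightarrow> a k > 0"
        then have "(\<Sum>k\<in>{1..<n}. a k) > 0" by (intro sum_pos) (use n2 in auto)
        with z show False by simp
      next
        assume "\<forall>k. 1 \<le> k \<and> k < n \<longrightarrow> a k < 0"
        then have "(\<Sum>k\<in>{1..<n}. - a k) > 0" by (intro sum_pos) (use n2 in auto)
        with z show False by (simp add: sum_negf)
      qed
    qed
    then consider "a 0 > 0" | "a 0 < 0" by linarith
    then show ?thesis
    proof cases
      case 1
      then have "a n < 0" using an[OF n] x by (simp add: mult_less_0_iff)
      then have "b k < 0" if "1 \<le> k" "k \<le> n" for k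
        using pos.inner_neg[of k] 1 IH b0 that unfolding one_sign_change_def by blast
      then show ?thesis using n by blast
    next
      case 2
      then have "- a n < 0" using an[OF n] x by (simp add: zero_less_mult_iff)
      moreover have "\<forall>i j. i \<le> j \<and> j \<le> n \<and> - a i \<le> 0 \<longrightarrow> - a j \<le> 0"
        using IH 2 unfolding one_sign_change_def neg_le_0_iff_le by blast
      ultimately have "- b k < 0" if "1 \<le> k" "k \<le> n" for k
        using neg.inner_neg[of k] 2 b0 that by simp
      then have "b k > 0" if "1 \<le> k" "k \<le> n" for k using that by simp
      then show ?thesis using n by blast
    qed
  qed
  have "one_sign_change (Suc n) b"
    unfolding one_sign_change_def using 1 2 3 by (auto simp: less_Suc_eq_le)
  then show ?case by (simp add: b_def)
qed

text \<open>At a root all inner values have the same sign as the one at index 1, which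
  \<open>eul_diff\<close> expresses by \<open>eul n 0\<close>.\<close>

lemma eul_sign_at_root:
  assumes x: "x < 0" and root: "poly (eul (Suc n) 0) x = 0" and k: "1 \<le> k" "k \<le> n"
  shows "poly (eul (Suc n) k) x * poly (eul n 0) x < 0"
proof -
  let ?b = "\<lambda>k. poly (eul (Suc n) k) x"
  have b1: "?b 1 = - (1 - x) * poly (eul n 0) x"
    using arg_cong[OF eul_diff[of 0 n], of "\<lambda>p. poly p x"] root by (simp add: algebra_simps)
  have "(\<forall>k. 1 \<le> k \<and> k < Suc n \<longrightarrow> ?b k > 0) \<or> (\<forall>k. 1 \<le> k \<and> k < Suc n \<longrightarrow> ?b k < 0)"
    using one_sign_change_eul[OF x, of "Suc n"] root unfolding one_sign_change_def by blast
  then have "?b k * ?b 1 > 0" using k by (auto simp: zero_less_mult_iff)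
  then have "(1 - x) * (?b k * poly (eul n 0) x) < 0" unfolding b1 by (simp add: algebra_simps)
  then show ?thesis using x by (simp add: mult_less_0_iff)
qed


section \<open>Roots\<close>

text \<open>The intermediate value theorem gives a root in each of the \<open>m\<close> gaps, and
  the degree leaves room for no others.\<close>

lemma alternating_poly_roots:
  fixes f :: "real poly"
  assumes t: "\<And>i. i < m \<Longrightarrow> t (Suc i) < t i"
    and sign: "\<And>i. i \<le> m \<Longrightarrow> (-1) ^ i * poly f (t i) > 0"
    and deg: "degree f \<le> m"
  shows "\<exists>\<beta>. (\<forall>i<m. t (Suc i) < \<beta> i \<and> \<beta> i < t i) \<and> f = smult (coeff f m) (\<Prod>i<m. [:- \<beta> i, 1:])"
proof -
  have "\<exists>y. t (Suc i) < y \<and> y < t i \<and> poly f y = 0" if "i < m" for i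
  proof (rule poly_IVT[OF t[OF that]])
    show "poly f (t (Suc i)) * poly f (t i) < 0"
      using sign[of i] sign[of "Suc i"] that by (cases "even i") (auto simp: mult_less_0_iff)
  qed
  then obtain \<beta> where \<beta>: "\<And>i. i < m \<Longrightarrow> t (Suc i) < \<beta> i \<and> \<beta> i < t i \<and> poly f (\<beta> i) = 0"
    by metis
  have anti: "t j \<le> t i" if "i \<le> j" "j \<le> m" for i j
    using that
  proof (induction j rule: dec_induct)
    case (step j)
    then show ?case using t[of j] by simp
  qed simp
  have less: "\<beta> j < \<beta> i" if "i < j" "j < m" for i j
  proof -
    have "\<beta> j < t j" "t j \<le> t (Suc i)" "t (Suc i) < \<beta> i"
      using \<beta>[of j] \<beta>[of i] anti[of "Suc i" j] that by auto
    then show ?thesis by linarith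
  qed
  then have inj: "inj_on \<beta> {..<m}" by (intro linorder_inj_onI) force+
  let ?P = "\<Prod>i<m. [:- \<beta> i, 1:]"
  have degP: "degree ?P = m"
    by (subst degree_prod_eq_sum_degree) auto
  have lead: "coeff ?P m = 1"
    using degP lead_coeff_prod[of "\<lambda>i. [:- \<beta> i, 1:]" "{..<m}"] by simp
  \<comment> \<open>Both sides have degree at most \<open>m\<close> and agree at \<open>m\<close>
    distinct roots and in the coefficient of degree \<open>m\<close>.\<close>
  have "f = smult (coeff f m) ?P"
  proof (rule poly_eqI_degree_lead_coeff[where n = m and A = "\<beta> ` {..<m}"])
    show "coeff f m = coeff (smult (coeff f m) ?P) m" using lead by simp
    show "m \<le> card (\<beta> ` {..<m})" using inj by (simp add: card_image)
    show "degree (smult (coeff f m) ?P) \<le> m" using degP by (metis degree_smult_le)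
    fix z assume "z \<in> \<beta> ` {..<m}"
    then obtain i where i: "i < m" "z = \<beta> i" by auto
    then have "(\<Prod>i<m. poly [:- \<beta> i, 1:] z) = 0" by (intro prod_zero) auto
    then show "poly f z = poly (smult (coeff f m) ?P) z" using \<beta> i by (simp add: poly_prod)
  qed (fact deg)
  then show ?thesis using \<beta> by blast
qed

text \<open>Exactly the first \<open>i\<close> factors are negative.\<close>

lemma sign_prod_linear:
  fixes \<alpha> :: "nat \<Rightarrow> real"
  assumes "i \<le> n" "\<And>j. j < i \<Longrightarrow> y < \<alpha> j" "\<And>j. i \<le> j \<Longrightarrow> j < n \<Longrightarrow> \<alpha> j < y"
  shows "(-1) ^ i * (\<Prod>j<n. y - \<alpha> j) > 0"
proof -
  have "{..<n} = {..<i} \<union> {i..<n}" using assms(1) by auto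
  then have "(\<Prod>j<n. y - \<alpha> j) = (\<Prod>j<i. y - \<alpha> j) * (\<Prod>j\<in>{i..<n}. y - \<alpha> j)"
    by (simp add: prod.union_disjoint ivl_disj_int)
  moreover have "(\<Prod>j<i. y - \<alpha> j) = (-1) ^ i * (\<Prod>j<i. \<alpha> j - y)"
  proof -
    have "(\<Prod>j<i. y - \<alpha> j) = (\<Prod>j<i. (-1) * (\<alpha> j - y))" by simp
    then show ?thesis by (simp only: prod.distrib prod_constant card_lessThan)
  qed
  moreover have "(\<Prod>j<i. \<alpha> j - y) > 0" by (rule prod_pos) (use assms in auto)
  moreover have "(\<Prod>j\<in>{i..<n}. y - \<alpha> j) > 0" by (rule prod_pos) (use assms in auto)
  moreover have "(-1::real) ^ i * (-1) ^ i = 1" by (simp flip: power_mult_distrib)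
  ultimately show ?thesis by (simp flip: mult.assoc)
qed

lemma monic_sign_at_minus_infinity:
  fixes f :: "real poly"
  assumes "degree f = m" "coeff f m = 1"
  shows "\<exists>y<z. (-1) ^ m * poly f y > 0"
proof -
  \<comment> \<open>Reflecting the argument and adjusting the sign makes the leading coefficient
    positive, so that the behaviour at plus infinity decides.\<close>
  define g where "g = smult ((-1) ^ m) (f \<circ>\<^sub>p [:0, -1:])"
  have "lead_coeff (f \<circ>\<^sub>p [:0, -1:]) = (-1) ^ m"
    using assms by (subst lead_coeff_comp) auto
  then have "lead_coeff g > 0"
    unfolding g_def lead_coeff_smult by (simp flip: power_mult_distrib)
  then obtain N where N: "\<And>u. u \<ge> N \<Longrightarrow> poly g u \<ge> lead_coeff g"
    using poly_pinfty_gt_lc[of g] by blast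
  define u where "u = max N (1 - z)"
  have "poly g u > 0" using N[of u] \<open>lead_coeff g > 0\<close> unfolding u_def by force
  then have "(-1) ^ m * poly f (- u) > 0" by (simp add: g_def poly_pcompose)
  moreover have "- u < z" unfolding u_def by linarith
  ultimately show ?thesis by blast
qed

text \<open>Induction on \<open>n\<close>. At the roots of one polynomial the next one alternates in
  sign: it is the sum of the \<open>eul (Suc n) j\<close>, whose end terms vanish there and whose
  inner terms share the sign given by \<open>eul_sign_at_root\<close>. The last conjunct passes the
  sign of \<open>eul n 0\<close> on to the next step.\<close>

lemma eul_0_roots:
  "\<exists>\<alpha>. (\<forall>i<n. \<alpha> i < 0) \<and> (\<forall>i j. i < j \<and> j < n \<longrightarrow> \<alpha> j < \<alpha> i) \<and>
     eul (Suc n) 0 = (\<Prod>i<n. [:- \<alpha> i, 1:]) \<and> (\<forall>i<n. (-1) ^ i * poly (eul n 0) (\<alpha> i) > 0)"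
proof (induction n)
  case 0
  show ?case using eul_Suc_0[of 0] by simp
next
  case (Suc n)
  then obtain \<alpha> where neg: "\<And>i. i < n \<Longrightarrow> \<alpha> i < 0" and desc: "\<And>i j. i < j \<Longrightarrow> j < n \<Longrightarrow> \<alpha> j < \<alpha> i"
    and prod: "eul (Suc n) 0 = (\<Prod>i<n. [:- \<alpha> i, 1:])"
    and sgn: "\<And>i. i < n \<Longrightarrow> (-1) ^ i * poly (eul n 0) (\<alpha> i) > 0" by blast
  let ?f = "eul (Suc (Suc n)) 0"
  have degf: "degree ?f \<le> Suc n" using degree_eul[of 0 "Suc (Suc n)"] by simp
  have cf: "coeff ?f (Suc n) = 1" by (rule coeff_eul_0)
  have degf': "degree ?f = Suc n"
    using degf cf le_degree[of ?f "Suc n"] by simp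
  \<comment> \<open>A point to the left of all roots, or of 0 if there are none, at which the
    leading term determines the sign.\<close>
  obtain y where y: "y < (if n = 0 then 0 else \<alpha> (n - 1))" "(-1) ^ Suc n * poly ?f y > 0"
    using monic_sign_at_minus_infinity[OF degf' cf] by blast
  have val: "(-1) ^ Suc i * poly ?f (\<alpha> i) > 0" if i: "i < n" for i
  proof -
    have root: "poly (eul (Suc n) 0) (\<alpha> i) = 0"
      unfolding prod poly_prod by (rule prod_zero) (use i in auto)
    have last: "poly (eul (Suc n) (Suc n)) (\<alpha> i) = 0" unfolding eul_last using root by simp
    have "(-1) ^ Suc i * poly ?f (\<alpha> i) = (\<Sum>j\<le>Suc n. (-1) ^ Suc i * poly (eul (Suc n) j) (\<alpha> i))"
      unfolding eul_Suc_0[of "Suc n"] poly_sum sum_distrib_left ..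
    also have "\<dots> = (\<Sum>j\<in>{1..n}. (-1) ^ Suc i * poly (eul (Suc n) j) (\<alpha> i))"
    proof (rule sum.mono_neutral_right)
      show "\<forall>j\<in>{..Suc n} - {1..n}. (-1) ^ Suc i * poly (eul (Suc n) j) (\<alpha> i) = 0"
      proof
        fix j assume "j \<in> {..Suc n} - {1..n}"
        then have "j = 0 \<or> j = Suc n" by auto
        then show "(-1) ^ Suc i * poly (eul (Suc n) j) (\<alpha> i) = 0" using root last by auto
      qed
    qed auto
    also have "\<dots> > 0"
    proof (rule sum_pos)
      fix j assume j: "j \<in> {1..n}"
      have "poly (eul (Suc n) j) (\<alpha> i) * poly (eul n 0) (\<alpha> i) < 0"
        by (rule eul_sign_at_root) (use root neg i j in auto)
      then show "(-1) ^ Suc i * poly (eul (Suc n) j) (\<alpha> i) > 0"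
        using sgn[OF i] by (cases "even i") (auto simp: mult_less_0_iff zero_less_mult_iff)
    qed (use i in auto)
    finally show ?thesis .
  qed
  \<comment> \<open>The test points from right to left: 0, where the value is 1, the
    \<open>n\<close> old roots, and the far left point \<open>y\<close>. They separate
    \<open>Suc n\<close> new roots.\<close>
  define t where "t i = (if i = 0 then 0 else if i \<le> n then \<alpha> (i - 1) else y)" for i
  have t: "t (Suc i) < t i" if "i < Suc n" for i
  proof (cases "i = n")
    case True
    then show ?thesis using y(1) by (auto simp: t_def split: if_splits)
  next
    case False
    then show ?thesis using that neg[of 0] desc[of "i - 1" i] by (auto simp: t_def)
  qed
  have "\<exists>\<beta>. (\<forall>i<Suc n. t (Suc i) < \<beta> i \<and> \<beta> i < t i) \<and> ?f = smult (coeff ?f (Suc n)) (\<Prod>i<Suc n. [:- \<beta> i, 1:])"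
  proof (rule alternating_poly_roots[of "Suc n" t, OF t _ degf])
    fix i assume "i \<le> Suc n"
    then consider "i = 0" | "1 \<le> i" "i \<le> n" | "i = Suc n" by linarith
    then show "(-1) ^ i * poly ?f (t i) > 0"
    proof cases
      case 1
      then show ?thesis using poly_eul_0[of "Suc (Suc n)" 0] by (simp add: t_def)
    next
      case 2
      then show ?thesis using val[of "i - 1"] by (simp add: t_def)
    next
      case 3
      then show ?thesis using y(2) by (simp add: t_def)
    qed
  qed
  then obtain \<beta> where \<beta>: "\<And>i. i < Suc n \<Longrightarrow> t (Suc i) < \<beta> i \<and> \<beta> i < t i"
    and f: "?f = (\<Prod>i<Suc n. [:- \<beta> i, 1:])" unfolding cf smult_1_left by blast
  have anti: "t j \<le> t i" if "i \<le> j" "j \<le> Suc n" for i j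
    using that
  proof (induction j rule: dec_induct)
    case (step j)
    then show ?case using t[of j] by simp
  qed simp
  have "\<beta> i < 0" if "i < Suc n" for i
  proof -
    have "\<beta> i < t i" "t i \<le> t 0" using \<beta>[OF that] anti[of 0 i] that by auto
    then show ?thesis by (simp add: t_def)
  qed
  moreover have "\<beta> j < \<beta> i" if "i < j" "j < Suc n" for i j
  proof -
    have "\<beta> j < t j" "t j \<le> t (Suc i)" "t (Suc i) < \<beta> i"
      using \<beta>[of j] \<beta>[of i] anti[of "Suc i" j] that by auto
    then show ?thesis by linarith
  qed
  \<comment> \<open>The new root of index \<open>i\<close> has exactly \<open>i\<close> old roots to
    its right.\<close>
  moreover have "(-1) ^ i * poly (eul (Suc n) 0) (\<beta> i) > 0" if i: "i < Suc n" for i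
  proof -
    have "poly (eul (Suc n) 0) (\<beta> i) = (\<Prod>j<n. \<beta> i - \<alpha> j)"
      unfolding prod poly_prod by simp
    moreover have "(-1) ^ i * (\<Prod>j<n. \<beta> i - \<alpha> j) > 0"
    proof (rule sign_prod_linear)
      fix j assume "j < i"
      then have "\<beta> i < t i" "t i \<le> t (Suc j)" using \<beta>[OF i] anti[of "Suc j" i] i by auto
      then show "\<beta> i < \<alpha> j" using \<open>j < i\<close> i by (simp add: t_def)
    next
      fix j assume j: "i \<le> j" "j < n"
      then have "t (Suc j) \<le> t (Suc i)" "t (Suc i) < \<beta> i" using \<beta>[OF i] anti[of "Suc i" "Suc j"] by auto
      then show "\<alpha> j < \<beta> i" using j by (simp add: t_def)
    qed (use i in auto)
    ultimately show ?thesis by simp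
  qed
  ultimately show ?case using f by blast
qed

lemma eul_sign_at_eul_0_root:
  assumes "\<And>i. i < n \<Longrightarrow> \<alpha> i < 0" "eul (Suc n) 0 = (\<Prod>i<n. [:- \<alpha> i, 1:])"
    and "\<And>i. i < n \<Longrightarrow> (-1) ^ i * poly (eul n 0) (\<alpha> i) > 0" and i: "i < n" and j: "j \<le> Suc n"
  shows "(-1) ^ Suc i * poly (eul (Suc n) j) (\<alpha> i) \<ge> 0"
    and "1 \<le> j \<Longrightarrow> j \<le> n \<Longrightarrow> (-1) ^ Suc i * poly (eul (Suc n) j) (\<alpha> i) > 0"
proof -
  have root: "poly (eul (Suc n) 0) (\<alpha> i) = 0"
    unfolding assms(2) poly_prod by (rule prod_zero) (use i in auto)
  have last: "poly (eul (Suc n) (Suc n)) (\<alpha> i) = 0" unfolding eul_last using root by simp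
  show pos: "(-1) ^ Suc i * poly (eul (Suc n) j) (\<alpha> i) > 0" if "1 \<le> j" "j \<le> n"
  proof -
    have "poly (eul (Suc n) j) (\<alpha> i) * poly (eul n 0) (\<alpha> i) < 0"
      by (rule eul_sign_at_root) (use root assms(1) i that in auto)
    then show ?thesis
      using assms(3)[OF i] by (cases "even i") (auto simp: mult_less_0_iff zero_less_mult_iff)
  qed
  show "(-1) ^ Suc i * poly (eul (Suc n) j) (\<alpha> i) \<ge> 0"
  proof (cases "j = 0 \<or> j = Suc n")
    case True
    then show ?thesis using root last by auto
  next
    case False
    then show ?thesis using pos j by (intro less_imp_le) auto
  qed
qed


section \<open>Interlacing\<close>

lemma roots_desc_prod_linear:
  fixes \<beta> :: "nat \<Rightarrow> real"
  assumes "\<And>i j. i < j \<Longrightarrow> j < m \<Longrightarrow> \<beta> j < \<beta> i" "c \<noteq> 0"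
  shows "roots_desc (smult c (\<Prod>i<m. [:- \<beta> i, 1:])) = map \<beta> [0..<m]"
proof -
  have "proots (smult c (\<Prod>i<m. [:- \<beta> i, 1:])) = (\<Sum>i<m. {#\<beta> i#})"
    using assms(2) by (simp add: proots_prod)
  also have "\<dots> = mset (rev (map \<beta> [0..<m]))"
    by (induction m) (auto simp: lessThan_Suc)
  finally have "roots_desc (smult c (\<Prod>i<m. [:- \<beta> i, 1:])) = rev (sort (rev (map \<beta> [0..<m])))"
    unfolding roots_desc_def by (simp only: sorted_list_of_multiset_mset)
  also have "sorted (rev (map \<beta> [0..<m]))"
    using assms(1) unfolding sorted_iff_nth_mono_less by (auto simp: rev_nth intro!: less_imp_le)
  then have "sort (rev (map \<beta> [0..<m])) = rev (map \<beta> [0..<m])" by (rule sorted_sort_id)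
  finally show ?thesis by simp
qed

lemma map_poly_of_real_linear_factor:
  "map_poly complex_of_real ([:- b, 1:] * p) = [:- of_real b, 1:] * map_poly of_real p"
  by (rule poly_eqI) (simp add: coeff_map_poly coeff_pCons split: nat.split)

lemma poly_map_poly_of_real_prod_linear:
  "poly (map_poly complex_of_real (\<Prod>i\<in>I. [:- \<beta> i, 1:])) z = (\<Prod>i\<in>I. z - of_real (\<beta> i))"
  by (induction I rule: infinite_finite_induct)
     (simp_all add: map_poly_of_real_linear_factor algebra_simps del: mult_pCons_left)

lemma real_rooted_prod_linear:
  assumes "finite I"
  shows "real_rooted (smult c (\<Prod>i\<in>I. [:- \<beta> i, 1:]))"
  using assms by (auto simp: real_rooted_def map_poly_smult poly_map_poly_of_real_prod_linear)

text \<open>Writing \<open>T\<close> as x times \<open>U\<close>, the negative arguments make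
  \<open>U\<close> alternate on the \<open>n\<close> points. This gives \<open>n - 1\<close> roots
  between them, and 0 is the largest root of \<open>T\<close>.\<close>

lemma eulerian_interlaces:
  assumes \<alpha>: "\<And>i. i < n \<Longrightarrow> \<alpha> i < 0" "\<And>i j. i < j \<Longrightarrow> j < n \<Longrightarrow> \<alpha> j < \<alpha> i"
    and T0: "poly T 0 = 0" and deg: "degree T \<le> n"
    and sign: "\<And>i. i < n \<Longrightarrow> (-1) ^ Suc i * poly T (\<alpha> i) > 0"
  shows "real_rooted T \<and> (\<Prod>i<n. [:- \<alpha> i, 1:]) \<preceq> T"
proof -
  have rr: "real_rooted (\<Prod>i<n. [:- \<alpha> i, 1:])" using real_rooted_prod_linear[of "{..<n}" 1] by simp
  obtain U where TU: "T = [:0, 1:] * U"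
    using T0 by (metis dvdE poly_eq_0_iff_dvd minus_zero)
  show ?thesis
  proof (cases n)
    case 0
    \<comment> \<open>A constant that vanishes at 0 is the zero polynomial, which is interlaced by
      convention.\<close>
    then obtain c where "T = [:c:]" using deg by (metis degree_eq_zeroE le_zero_eq)
    then have "T = 0" using T0 by simp
    then show ?thesis using rr by (simp add: interlaces_def real_rooted_def)
  next
    case (Suc m)
    have U0: "U \<noteq> 0" using sign[of 0] Suc TU by auto
    then have "degree U \<le> m" using deg TU Suc by (simp add: degree_mult_eq)
    have "\<exists>\<beta>. (\<forall>i<m. \<alpha> (Suc i) < \<beta> i \<and> \<beta> i < \<alpha> i) \<and> U = smult (coeff U m) (\<Prod>i<m. [:- \<beta> i, 1:])"
    proof (rule alternating_poly_roots[of m \<alpha>, OF _ _ \<open>degree U \<le> m\<close>])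
      fix i assume "i \<le> m"
      then have "i < n" using Suc by simp
      have "- \<alpha> i * ((-1) ^ i * poly U (\<alpha> i)) > 0" using sign[OF \<open>i < n\<close>] unfolding TU by (simp add: algebra_simps)
      then show "(-1) ^ i * poly U (\<alpha> i) > 0" using \<alpha>(1)[OF \<open>i < n\<close>] by (simp only: zero_less_mult_iff) auto
    qed (use \<alpha> Suc in auto)
    then obtain \<gamma> where \<gamma>: "\<And>i. i < m \<Longrightarrow> \<alpha> (Suc i) < \<gamma> i \<and> \<gamma> i < \<alpha> i"
      and U: "U = smult (coeff U m) (\<Prod>i<m. [:- \<gamma> i, 1:])" by blast
    \<comment> \<open>The root 0 is put in front of the roots of \<open>U\<close>, whose indices
      therefore shift by one.\<close>
    define c where "c = coeff U m"
    have c: "c \<noteq> 0" using U U0 unfolding c_def by force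
    define \<beta> where "\<beta> i = (case i of 0 \<Rightarrow> 0 | Suc k \<Rightarrow> \<gamma> k)" for i
    have T: "T = smult c (\<Prod>i<n. [:- \<beta> i, 1:])"
    proof -
      have "(\<Prod>i<n. [:- \<beta> i, 1:]) = [:0, 1:] * (\<Prod>i<m. [:- \<gamma> i, 1:])"
        unfolding Suc prod.lessThan_Suc_shift by (simp add: \<beta>_def)
      then show ?thesis using TU U unfolding c_def by (metis mult_smult_right)
    qed
    have \<alpha>\<beta>: "\<alpha> i < \<beta> i" if "i < n" for i
      using that \<alpha>(1)[of 0] \<gamma>[of "i - 1"] Suc by (cases i) (auto simp: \<beta>_def)
    have \<beta>\<alpha>: "\<beta> (Suc i) < \<alpha> i" if "Suc i < n" for i
      using that \<gamma>[of i] Suc by (auto simp: \<beta>_def)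
    have desc: "\<beta> j < \<beta> i" if "i < j" "j < n" for i j
    proof -
      obtain k where k: "j = Suc k" using \<open>i < j\<close> by (cases j) simp_all
      have "\<alpha> k \<le> \<alpha> i" using \<alpha>(2)[of i k] that k by (cases "i = k") auto
      then show ?thesis using \<beta>\<alpha>[of k] \<alpha>\<beta>[of i] that k by auto
    qed
    have rT: "roots_desc T = map \<beta> [0..<n]" unfolding T by (rule roots_desc_prod_linear[OF desc c])
    have rA: "roots_desc (\<Prod>i<n. [:- \<alpha> i, 1:]) = map \<alpha> [0..<n]"
      using roots_desc_prod_linear[of n \<alpha> 1] \<alpha>(2) by simp
    have "real_rooted T" unfolding T by (rule real_rooted_prod_linear) simp
    then show ?thesis unfolding interlaces_def Let_def rT rA
      using rr \<alpha>\<beta> \<beta>\<alpha> by (auto intro: less_imp_le)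
  qed
qed

section \<open>Simplicial subdivisions of an orthant\<close>

lemma sum_interval_powers:
  fixes a b :: "'a::comm_ring_1"
  assumes "finite V" "C \<subseteq> V"
  shows "(\<Sum>F | C \<subseteq> F \<and> F \<subseteq> V. a ^ (card V - card F) * b ^ (card F - card C)) = (b + a) ^ (card V - card C)"
proof -
  have fC: "finite C" using assms finite_subset by blast
  have "(b + a) ^ (card V - card C) = (\<Prod>x\<in>V - C. b + a)"
    using assms fC by (simp add: card_Diff_subset)
  also have "\<dots> = (\<Sum>X\<in>Pow (V - C). b ^ card X * a ^ card (V - C - X))"
    by (subst prod_add) (use assms in auto)
  also have "\<dots> = (\<Sum>F | C \<subseteq> F \<and> F \<subseteq> V. a ^ (card V - card F) * b ^ (card F - card C))"
  proof (rule sum.reindex_bij_witness[of _ "\<lambda>F. F - C" "\<lambda>X. C \<union> X"])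
    fix X assume "X \<in> Pow (V - C)"
    then have X: "X \<subseteq> V - C" "C \<inter> X = {}" by auto
    have fX: "finite X" by (rule finite_subset[OF X(1)]) (use assms in simp)
    have "V - C - X = V - (C \<union> X)" by auto
    then have "card (V - C - X) = card V - card (C \<union> X)"
      using X fX assms fC by (simp only:) (rule card_Diff_subset, auto)
    moreover have "card (C \<union> X) - card C = card X" using X fX fC by (simp add: card_Un_disjoint)
    ultimately show "a ^ (card V - card (C \<union> X)) * b ^ (card (C \<union> X) - card C)
      = b ^ card X * a ^ card (V - C - X)" by simp
  qed (use assms in auto)
  finally show ?thesis ..
qed

text \<open>Gaussian elimination by induction on the equations \<open>W\<close>: an equation that is
  not identically zero is solved for one unknown.\<close>

lemma homogeneous_system_nontrivial:
  fixes l :: "'w \<Rightarrow> 'v \<Rightarrow> 'a::field"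
  assumes "finite W" "finite V" "card W < card V"
  shows "\<exists>m. (\<exists>i\<in>V. m i \<noteq> 0) \<and> (\<forall>w\<in>W. (\<Sum>i\<in>V. m i * l w i) = 0)"
  using assms
proof (induction W arbitrary: V l rule: finite_induct)
  case empty
  then obtain i where "i \<in> V" by (metis card.empty card_gt_0_iff equals0I)
  then show ?case by (intro exI[of _ "\<lambda>_. 1"]) auto
next
  case (insert w0 W)
  show ?case
  proof (cases "\<forall>i\<in>V. l w0 i = 0")
    case True
    have "card W < card V" using insert by simp
    then obtain m where m: "\<exists>i\<in>V. m i \<noteq> 0" "\<forall>w\<in>W. (\<Sum>i\<in>V. m i * l w i) = 0"
      using insert.IH[of V l] insert.prems by blast
    moreover have "(\<Sum>i\<in>V. m i * l w0 i) = 0" using True by simp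
    ultimately show ?thesis by blast
  next
    case False
    then obtain i0 where i0: "i0 \<in> V" "l w0 i0 \<noteq> 0" by blast
    define V' where "V' = V - {i0}"
    \<comment> \<open>The remaining equations after the unknown \<open>i0\<close> has been
      eliminated by means of equation \<open>w0\<close>.\<close>
    define l' where "l' w i = l w i - l w i0 * l w0 i / l w0 i0" for w i
    have V: "V = insert i0 V'" "i0 \<notin> V'" "finite V'" using i0 insert.prems by (auto simp: V'_def)
    have "card W < card V'" using insert.prems insert.hyps V by simp
    then obtain m where m: "\<exists>i\<in>V'. m i \<noteq> 0" "\<forall>w\<in>W. (\<Sum>i\<in>V'. m i * l' w i) = 0"
      using insert.IH[of V' l'] V by blast
    define s where "s = (\<Sum>i\<in>V'. m i * l w0 i) / l w0 i0"
    define m' where "m' = m(i0 := - s)"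
    have sum: "(\<Sum>i\<in>V. m' i * l w i) = (\<Sum>i\<in>V'. m i * l w i) - s * l w i0" for w
    proof -
      have "(\<Sum>i\<in>V'. m' i * l w i) = (\<Sum>i\<in>V'. m i * l w i)"
        by (rule sum.cong) (use V in \<open>auto simp: m'_def\<close>)
      then show ?thesis using V by (simp add: m'_def)
    qed
    have "(\<Sum>i\<in>V. m' i * l w i) = 0" if "w \<in> W" for w
    proof -
      have "s * l w i0 = (\<Sum>i\<in>V'. m i * (l w i0 * l w0 i / l w0 i0))"
        unfolding s_def sum_divide_distrib sum_distrib_right by (intro sum.cong) auto
      then have "(\<Sum>i\<in>V'. m i * l' w i) = (\<Sum>i\<in>V'. m i * l w i) - s * l w i0"
        unfolding l'_def right_diff_distrib sum_subtractf by simp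
      then show ?thesis using m(2) that sum by simp
    qed
    moreover have "(\<Sum>i\<in>V. m' i * l w0 i) = 0" unfolding sum s_def using i0 by simp
    moreover have "\<exists>i\<in>V. m' i \<noteq> 0" using m(1) V by (auto simp: m'_def)
    ultimately show ?thesis by blast
  qed
qed

text \<open>Each span is annihilated by a nonzero functional \<open>m H\<close>. On the curve with
  coordinates plus or minus powers of \<open>t\<close> the functional becomes a nonzero polynomial
  in \<open>t\<close>, so all but finitely many positive \<open>t\<close> avoid every span, and the
  signs can be prescribed freely.\<close>

lemma generic_point:
  fixes l :: "'w \<Rightarrow> 'v \<Rightarrow> real"
  assumes V: "finite V" and fin: "finite \<H>" and H: "\<And>H. H \<in> \<H> \<Longrightarrow> finite H \<and> card H < card V"
  shows "\<exists>\<xi>. (\<forall>i\<in>V. \<xi> i \<noteq> 0 \<and> (\<xi> i < 0 \<longleftrightarrow> i \<in> S)) \<and>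
           (\<forall>H\<in>\<H>. \<forall>a. \<exists>i\<in>V. \<xi> i \<noteq> (\<Sum>w\<in>H. a w * l w i))"
proof -
  have "\<forall>H\<in>\<H>. \<exists>m. (\<exists>i\<in>V. m i \<noteq> 0) \<and> (\<forall>w\<in>H. (\<Sum>i\<in>V. m i * l w i) = 0)"
    using homogeneous_system_nontrivial[OF _ V] H by blast
  then obtain m where m: "\<forall>H\<in>\<H>. (\<exists>i\<in>V. m H i \<noteq> 0) \<and> (\<forall>w\<in>H. (\<Sum>i\<in>V. m H i * l w i) = 0)"
    by (rule bchoice[THEN exE])
  \<comment> \<open>Distinct exponents keep the terms of \<open>P H\<close> from cancelling.\<close>
  obtain k :: "'v \<Rightarrow> nat" where k: "inj_on k V"
    using finite_imp_inj_to_nat_seg[OF V] by blast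
  define s where "s i = (if i \<in> S then - 1 else 1 :: real)" for i
  define P where "P H = (\<Sum>i\<in>V. monom (m H i * s i) (k i))" for H
  have P: "P H \<noteq> 0" if "H \<in> \<H>" for H
  proof -
    obtain i where i: "i \<in> V" "m H i \<noteq> 0" using m \<open>H \<in> \<H>\<close> by blast
    have "coeff (P H) (k i) = (\<Sum>j\<in>V. if j = i then m H i * s i else 0)"
      unfolding P_def coeff_sum coeff_monom
      by (rule sum.cong) (use k i in \<open>auto simp: inj_on_def\<close>)
    also have "\<dots> = m H i * s i" using i V by simp
    finally show ?thesis using i by (auto simp: s_def split: if_splits)
  qed
  then have "(\<Prod>H\<in>\<H>. P H) \<noteq> 0" using fin by simp
  then have "finite {t. poly (\<Prod>H\<in>\<H>. P H) t = 0}" by (rule poly_roots_finite)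
  then have "infinite ({0<..} - {t. poly (\<Prod>H\<in>\<H>. P H) t = 0})"
    by (rule Diff_infinite_finite[OF _ infinite_Ioi])
  then obtain t where "t \<in> {0<..} - {t. poly (\<Prod>H\<in>\<H>. P H) t = 0}"
    using infinite_imp_nonempty by blast
  then have t: "t > 0" "poly (\<Prod>H\<in>\<H>. P H) t \<noteq> 0" by auto
  define \<xi> where "\<xi> i = s i * t ^ k i" for i
  have "\<exists>i\<in>V. \<xi> i \<noteq> (\<Sum>w\<in>H. a w * l w i)" if "H \<in> \<H>" for H a
  proof (rule ccontr)
    assume "\<not> ?thesis"
    then have "(\<Sum>i\<in>V. m H i * \<xi> i) = (\<Sum>i\<in>V. m H i * (\<Sum>w\<in>H. a w * l w i))" by simp
    also have "\<dots> = (\<Sum>w\<in>H. a w * (\<Sum>i\<in>V. m H i * l w i))"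
      unfolding sum_distrib_left by (subst sum.swap) (simp add: mult_ac)
    also have "\<dots> = 0" using m that by simp
    also have "(\<Sum>i\<in>V. m H i * \<xi> i) = poly (P H) t"
      by (simp add: P_def \<xi>_def poly_sum poly_monom mult_ac)
    finally have "poly (\<Prod>H\<in>\<H>. P H) t = 0" unfolding poly_prod using fin that by (auto intro: prod_zero)
    then show False using t by simp
  qed
  moreover have "\<xi> i \<noteq> 0 \<and> (\<xi> i < 0 \<longleftrightarrow> i \<in> S)" for i
    using t by (auto simp: \<xi>_def s_def)
  ultimately show ?thesis by blast
qed

lemma coeff_mult_top:
  assumes "degree p \<le> a" "degree q \<le> b"
  shows "coeff (p * q) (a + b) = coeff p a * coeff q b"
proof (cases "degree p = a \<and> degree q = b")
  case True
  then show ?thesis using coeff_mult_degree_sum[of p q] by auto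
next
  case False
  then have "degree p + degree q < a + b" using assms by auto
  then have "degree (p * q) < a + b" using degree_mult_le[of p q] by simp
  moreover have "coeff p a = 0 \<or> coeff q b = 0" using False assms coeff_eq_0 by (metis le_neq_implies_less)
  ultimately show ?thesis by (auto simp: coeff_eq_0)
qed

text \<open>The simplices of \<open>\<Gamma>\<close> span simplicial cones subdividing the nonnegative orthant of \<open>\<real>\<^bsup>V\<^esup>\<close>;
  \<open>l w\<close> is the generator belonging to the vertex \<open>w\<close>.\<close>

locale cone_subdivision =
  fixes V :: "'v set" and \<Gamma> :: "'w set set" and l :: "'w \<Rightarrow> 'v \<Rightarrow> real"
  assumes finite_V: "finite V"
    and complex: "abstract_complex \<Gamma>"
    and nonneg: "\<And>G w i. G \<in> \<Gamma> \<Longrightarrow> w \<in> G \<Longrightarrow> i \<in> V \<Longrightarrow> l w i \<ge> 0"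
    and indep: "\<And>G a w. G \<in> \<Gamma> \<Longrightarrow> (\<And>i. i \<in> V \<Longrightarrow> (\<Sum>w\<in>G. a w * l w i) = 0) \<Longrightarrow> w \<in> G \<Longrightarrow> a w = 0"
    and cover: "\<And>\<xi>. (\<And>i. i \<in> V \<Longrightarrow> \<xi> i \<ge> 0) \<Longrightarrow>
      \<exists>G\<in>\<Gamma>. \<exists>a. (\<forall>w\<in>G. a w \<ge> 0) \<and> (\<forall>i\<in>V. \<xi> i = (\<Sum>w\<in>G. a w * l w i))"
    and unique: "\<And>G H a b. G \<in> \<Gamma> \<Longrightarrow> H \<in> \<Gamma> \<Longrightarrow> (\<And>w. w \<in> G \<Longrightarrow> a w > 0) \<Longrightarrow> (\<And>w. w \<in> H \<Longrightarrow> b w > 0) \<Longrightarrow>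
      (\<And>i. i \<in> V \<Longrightarrow> (\<Sum>w\<in>G. a w * l w i) = (\<Sum>w\<in>H. b w * l w i)) \<Longrightarrow> G = H"
begin

text \<open>The coordinates of the smallest face of the orthant that contains the cone over
  \<open>G\<close>.\<close>

definition carr :: "'w set \<Rightarrow> 'v set" where
  "carr G = {i \<in> V. \<exists>w\<in>G. l w i > 0}"

lemma finite_\<Gamma>: "finite \<Gamma>" and empty_in: "{} \<in> \<Gamma>"
  and finite_face: "G \<in> \<Gamma> \<Longrightarrow> finite G" and subface: "G \<in> \<Gamma> \<Longrightarrow> H \<subseteq> G \<Longrightarrow> H \<in> \<Gamma>"
  using complex by (auto simp: abstract_complex_def)

lemma carr_subset: "carr G \<subseteq> V" by (auto simp: carr_def)

lemma finite_carr: "finite (carr G)" using carr_subset finite_V finite_subset by blast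

lemma l_eq_0: "G \<in> \<Gamma> \<Longrightarrow> w \<in> G \<Longrightarrow> i \<in> V \<Longrightarrow> i \<notin> carr G \<Longrightarrow> l w i = 0"
  using nonneg[of G w i] by (force simp: carr_def)

text \<open>The generators are supported on \<open>carr G\<close>; more of them than coordinates
  would be linearly dependent.\<close>

lemma card_le_card_carr:
  assumes G: "G \<in> \<Gamma>"
  shows "card G \<le> card (carr G)"
proof (rule ccontr)
  assume "\<not> ?thesis"
  then obtain a where a: "\<exists>w\<in>G. a w \<noteq> 0" "\<forall>i\<in>carr G. (\<Sum>w\<in>G. a w * l w i) = 0"
    using homogeneous_system_nontrivial[of "carr G" G "\<lambda>i w. l w i"] finite_carr[of G] finite_face[OF G] by auto
  have "(\<Sum>w\<in>G. a w * l w i) = 0" if "i \<in> V" for i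
    using a(2) l_eq_0[OF G _ that] by (cases "i \<in> carr G") auto
  then show False using indep[OF G] a(1) by blast
qed

lemma card_le: "G \<in> \<Gamma> \<Longrightarrow> card G \<le> card V"
  using card_le_card_carr card_mono[OF finite_V carr_subset] le_trans by blast

lemma coefficients_unique:
  assumes G: "G \<in> \<Gamma>" and eq: "\<And>i. i \<in> V \<Longrightarrow> (\<Sum>w\<in>G. a w * l w i) = (\<Sum>w\<in>G. b w * l w i)" and "w \<in> G"
  shows "a w = b w"
proof -
  have "a w - b w = 0"
    by (rule indep[OF G, of "\<lambda>w. a w - b w"]) (use assms in \<open>auto simp: left_diff_distrib sum_subtractf\<close>)
  then show ?thesis by simp
qed

text \<open>Generators with coefficient 0 are dropped, which leaves a subface.\<close>

lemma cover_positive: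
  assumes "\<And>i. i \<in> V \<Longrightarrow> \<xi> i \<ge> 0"
  shows "\<exists>G\<in>\<Gamma>. \<exists>a. (\<forall>w\<in>G. a w > 0) \<and> (\<forall>i\<in>V. \<xi> i = (\<Sum>w\<in>G. a w * l w i))"
proof -
  obtain G a where G: "G \<in> \<Gamma>" "\<forall>w\<in>G. a w \<ge> 0" "\<forall>i\<in>V. \<xi> i = (\<Sum>w\<in>G. a w * l w i)"
    using cover[of \<xi>] assms by blast
  have "(\<Sum>w\<in>G. a w * l w i) = (\<Sum>w\<in>{w \<in> G. a w > 0}. a w * l w i)" for i
    by (rule sum.mono_neutral_right) (use G finite_face in \<open>auto simp: less_le\<close>)
  then show ?thesis using G subface[of G "{w \<in> G. a w > 0}"]
    by (intro bexI[of _ "{w \<in> G. a w > 0}"] exI[of _ a]) auto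
qed

section \<open>Generic vectors, facets and the partition into intervals\<close>

definition generic :: "('v \<Rightarrow> real) \<Rightarrow> bool" where
  "generic \<xi> \<longleftrightarrow> (\<forall>i\<in>V. \<xi> i \<noteq> 0) \<and>
     (\<forall>H\<in>\<Gamma>. card H < card V \<longrightarrow> (\<forall>a. \<exists>i\<in>V. \<xi> i \<noteq> (\<Sum>w\<in>H. a w * l w i)))"

lemma ex_generic: "\<exists>\<xi>. generic \<xi> \<and> (\<forall>i\<in>V. \<xi> i < 0 \<longleftrightarrow> i \<in> S)"
proof -
  have "finite H \<and> card H < card V" if "H \<in> {H \<in> \<Gamma>. card H < card V}" for H
    using that finite_face by simp
  then obtain \<xi> where "\<forall>i\<in>V. \<xi> i \<noteq> 0 \<and> (\<xi> i < 0 \<longleftrightarrow> i \<in> S)"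
    "\<forall>H\<in>{H \<in> \<Gamma>. card H < card V}. \<forall>a. \<exists>i\<in>V. \<xi> i \<noteq> (\<Sum>w\<in>H. a w * l w i)"
    using generic_point[OF finite_V finite_subset[OF _ finite_\<Gamma>], of "{H \<in> \<Gamma>. card H < card V}" S l]
    by blast
  then show ?thesis unfolding generic_def by blast
qed

text \<open>The coefficients may have either sign, so the linear span of \<open>G\<close> is meant
  rather than its cone. For generic \<open>\<xi>\<close> all members have full dimension by
  \<open>card_facet\<close>.\<close>

definition facets :: "('v \<Rightarrow> real) \<Rightarrow> 'w set set" where
  "facets \<xi> = {G \<in> \<Gamma>. \<exists>a. \<forall>i\<in>V. \<xi> i = (\<Sum>w\<in>G. a w * l w i)}"

definition coord :: "('v \<Rightarrow> real) \<Rightarrow> 'w set \<Rightarrow> 'w \<Rightarrow> real" where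
  "coord \<xi> G = (SOME a. \<forall>i\<in>V. \<xi> i = (\<Sum>w\<in>G. a w * l w i))"

definition negpart :: "('v \<Rightarrow> real) \<Rightarrow> 'w set \<Rightarrow> 'w set" where
  "negpart \<xi> G = {w \<in> G. coord \<xi> G w < 0}"

lemma coord: "G \<in> facets \<xi> \<Longrightarrow> i \<in> V \<Longrightarrow> \<xi> i = (\<Sum>w\<in>G. coord \<xi> G w * l w i)"
proof -
  assume "G \<in> facets \<xi>" and i: "i \<in> V"
  then have "\<exists>a. \<forall>i\<in>V. \<xi> i = (\<Sum>w\<in>G. a w * l w i)" by (simp add: facets_def)
  then have "\<forall>i\<in>V. \<xi> i = (\<Sum>w\<in>G. coord \<xi> G w * l w i)" unfolding coord_def by (rule someI_ex)
  with i show ?thesis by blast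
qed

lemma facets_subset: "facets \<xi> \<subseteq> \<Gamma>" by (auto simp: facets_def)

lemma card_facet:
  assumes "generic \<xi>" "G \<in> facets \<xi>"
  shows "card G = card V"
proof (rule antisym)
  show "card G \<le> card V" using assms facets_subset card_le by blast
  show "card V \<le> card G"
  proof (rule ccontr)
    assume "\<not> ?thesis"
    moreover obtain a where "\<forall>i\<in>V. \<xi> i = (\<Sum>w\<in>G. a w * l w i)" "G \<in> \<Gamma>"
      using assms(2) by (auto simp: facets_def)
    ultimately show False using assms(1) unfolding generic_def by force
  qed
qed

text \<open>A zero coordinate would put \<open>\<xi>\<close> into the span of a smaller face; this
  is why \<open>generic\<close> excludes spans and not only cones.\<close>

lemma coord_nonzero:
  assumes gen: "generic \<xi>" and G: "G \<in> facets \<xi>" and w: "w \<in> G"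
  shows "coord \<xi> G w \<noteq> 0"
proof
  assume 0: "coord \<xi> G w = 0"
  have \<Gamma>: "G \<in> \<Gamma>" using G facets_subset by blast
  have "\<xi> i = (\<Sum>v\<in>G - {w}. coord \<xi> G v * l v i)" if "i \<in> V" for i
    using coord[OF G that] finite_face[OF \<Gamma>] w 0 by (simp add: sum.remove)
  moreover have "G - {w} \<in> \<Gamma>" using \<Gamma> subface by blast
  moreover have "card (G - {w}) < card V"
    using card_facet[OF gen G] finite_face[OF \<Gamma>] w by (metis card_Diff1_less)
  ultimately show False using gen unfolding generic_def by blast
qed

text \<open>For a face \<open>\<tau>\<close> whose carrier contains all negative directions of \<open>\<xi>\<close>, moving from the interior
  of \<open>\<tau>\<close> slightly into the direction \<open>\<xi>\<close> ends in the interior of exactly one facet. Instead of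
  small steps, large multiples of an interior point \<open>b\<close> of \<open>\<tau>\<close> are added to \<open>\<xi>\<close>.\<close>

lemma ex_facet:
  assumes gen: "generic \<xi>" and \<tau>: "\<tau> \<in> \<Gamma>" and sub: "{i \<in> V. \<xi> i < 0} \<subseteq> carr \<tau>"
  shows "\<exists>\<sigma>\<in>facets \<xi>. negpart \<xi> \<sigma> \<subseteq> \<tau> \<and> \<tau> \<subseteq> \<sigma>"
proof -
  define b where "b i = (\<Sum>w\<in>\<tau>. l w i)" for i
  define P where "P M G c \<longleftrightarrow> (\<forall>w\<in>G. c w > 0) \<and> (\<forall>i\<in>V. \<xi> i + real M * b i = (\<Sum>w\<in>G. c w * l w i))"
    for M :: nat and G c
  have b0: "b i \<ge> 0" if "i \<in> V" for i
    unfolding b_def by (rule sum_nonneg) (use nonneg \<tau> that in auto)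
  have bpos: "b i > 0" if i: "i \<in> carr \<tau>" for i
  proof -
    obtain w where "w \<in> \<tau>" "l w i > 0" "i \<in> V" using i by (auto simp: carr_def)
    then show ?thesis unfolding b_def using nonneg[OF \<tau>] finite_face[OF \<tau>] by (intro sum_pos2) auto
  qed
  have "\<forall>\<^sub>F M in sequentially. \<forall>i\<in>V. \<xi> i + real M * b i \<ge> 0"
  proof (rule eventually_ball_finite[OF finite_V], rule ballI)
    fix i assume i: "i \<in> V"
    show "\<forall>\<^sub>F M in sequentially. \<xi> i + real M * b i \<ge> 0"
    proof (cases "i \<in> carr \<tau>")
      case True
      obtain N :: nat where N: "real N > \<bar>\<xi> i\<bar> / b i" using reals_Archimedean2 by blast
      show ?thesis
      proof (rule eventually_sequentiallyI)
        fix M assume "N \<le> M"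
        then have "\<bar>\<xi> i\<bar> / b i < real M" using N by simp
        then show "\<xi> i + real M * b i \<ge> 0" using bpos[OF True] by (simp add: divide_simps)
      qed
    next
      case False
      then have "\<xi> i \<ge> 0" using sub i by force
      then show ?thesis using b0[OF i] by simp
    qed
  qed
  then obtain M0 where M0: "\<And>M i. M \<ge> M0 \<Longrightarrow> i \<in> V \<Longrightarrow> \<xi> i + real M * b i \<ge> 0"
    unfolding eventually_sequentially by blast
  \<comment> \<open>Infinitely many multiples are distributed over finitely many faces, so one face
    \<open>\<sigma>\<close> occurs infinitely often.\<close>
  have "{M0..} \<subseteq> (\<Union>G\<in>\<Gamma>. {M. \<exists>c. P M G c})"
    using cover_positive M0 unfolding P_def by fastforce
  then have "\<not> finite (\<Union>G\<in>\<Gamma>. {M. \<exists>c. P M G c})"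
    using infinite_Ici finite_subset by blast
  then obtain \<sigma> where \<sigma>: "\<sigma> \<in> \<Gamma>" and inf: "infinite {M. \<exists>c. P M \<sigma> c}"
    using finite_\<Gamma> by blast
  obtain M1 c1 where 1: "P M1 \<sigma> c1" using inf not_finite_existsD by blast
  obtain M2 c2 where 2: "P M2 \<sigma> c2" "M2 > M1" using inf unfolding infinite_nat_iff_unbounded by blast
  \<comment> \<open>Two multiples with the same face give two linear equations, solved here for the
    coordinates \<open>\<beta>\<close> of \<open>b\<close> and \<open>a\<close> of
    \<open>\<xi>\<close> in \<open>\<sigma>\<close>.\<close>
  define \<beta> where "\<beta> w = (c2 w - c1 w) / (real M2 - real M1)" for w
  define a where "a w = c1 w - real M1 * \<beta> w" for w
  have b: "b i = (\<Sum>w\<in>\<sigma>. \<beta> w * l w i)" if "i \<in> V" for i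
  proof -
    have "\<xi> i + real M1 * b i = (\<Sum>w\<in>\<sigma>. c1 w * l w i)" "\<xi> i + real M2 * b i = (\<Sum>w\<in>\<sigma>. c2 w * l w i)"
      using 1 2(1) that unfolding P_def by auto
    then have "(real M2 - real M1) * b i = (\<Sum>w\<in>\<sigma>. c2 w * l w i) - (\<Sum>w\<in>\<sigma>. c1 w * l w i)"
      by (simp add: left_diff_distrib)
    also have "\<dots> = (real M2 - real M1) * (\<Sum>w\<in>\<sigma>. \<beta> w * l w i)"
      using 2(2) unfolding \<beta>_def sum_distrib_left sum_subtractf[symmetric]
      by (intro sum.cong refl) (simp flip: left_diff_distrib)
    finally show ?thesis using 2(2) by simp
  qed
  have a: "\<xi> i = (\<Sum>w\<in>\<sigma>. a w * l w i)" if "i \<in> V" for i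
  proof -
    have "\<xi> i = (\<Sum>w\<in>\<sigma>. c1 w * l w i) - real M1 * b i" using 1 that unfolding P_def by (auto simp: algebra_simps)
    then show ?thesis unfolding b[OF that] a_def
      by (simp add: left_diff_distrib sum_subtractf sum_distrib_left mult.assoc)
  qed
  have fac: "\<sigma> \<in> facets \<xi>" using \<sigma> a by (auto simp: facets_def)
  have pos: "a w + real M * \<beta> w > 0" if c: "P M \<sigma> c" and w: "w \<in> \<sigma>" for M c w
  proof -
    have "c w = a w + real M * \<beta> w"
    proof (rule coefficients_unique[OF \<sigma> _ w])
      fix i assume i: "i \<in> V"
      have "(\<Sum>w\<in>\<sigma>. c w * l w i) = \<xi> i + real M * b i" using c i by (simp add: P_def)
      then show "(\<Sum>w\<in>\<sigma>. c w * l w i) = (\<Sum>w\<in>\<sigma>. (a w + real M * \<beta> w) * l w i)"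
        using a[OF i] b[OF i] by (simp add: distrib_right sum.distrib sum_distrib_left mult.assoc)
    qed
    then show ?thesis using c w by (auto simp: P_def)
  qed
  \<comment> \<open>A negative \<open>\<beta> w\<close> would make
    \<open>a w + real M * \<beta> w\<close> negative for large \<open>M\<close>.\<close>
  have \<beta>0: "\<beta> w \<ge> 0" if w: "w \<in> \<sigma>" for w
  proof (rule ccontr)
    assume "\<not> \<beta> w \<ge> 0"
    then have neg: "- \<beta> w > 0" by simp
    obtain N :: nat where N: "real N > a w / - \<beta> w" using reals_Archimedean2 by blast
    obtain M c where M: "P M \<sigma> c" "M > N" using inf unfolding infinite_nat_iff_unbounded by blast
    then have "a w / - \<beta> w < real M" using N by linarith
    then have "a w < real M * - \<beta> w" using neg by (simp only: pos_divide_less_eq)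
    then show False using pos[OF M(1) w] by simp
  qed
  \<comment> \<open>The point \<open>b\<close> has all coefficients 1 in \<open>\<tau>\<close> and
    positive ones on the support of \<open>\<beta>\<close>, so \<open>unique\<close> identifies the
    two faces.\<close>
  have \<tau>_eq: "\<tau> = {w \<in> \<sigma>. \<beta> w > 0}"
  proof (rule unique[OF \<tau> subface[OF \<sigma>], of _ "\<lambda>_. 1" \<beta>])
    fix i assume i: "i \<in> V"
    have "(\<Sum>w\<in>\<tau>. 1 * l w i) = (\<Sum>w\<in>\<sigma>. \<beta> w * l w i)" using b[OF i] by (simp add: b_def)
    also have "\<dots> = (\<Sum>w\<in>{w \<in> \<sigma>. \<beta> w > 0}. \<beta> w * l w i)"
      by (rule sum.mono_neutral_right) (use \<beta>0 \<sigma> finite_face in \<open>auto simp: less_le\<close>)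
    finally show "(\<Sum>w\<in>\<tau>. 1 * l w i) = (\<Sum>w\<in>{w \<in> \<sigma>. \<beta> w > 0}. \<beta> w * l w i)" .
  qed auto
  \<comment> \<open>Outside \<open>\<tau>\<close> adding multiples of \<open>b\<close> changes
    nothing, so the coordinate of \<open>\<xi>\<close> is itself positive.\<close>
  have "w \<in> \<tau>" if w: "w \<in> negpart \<xi> \<sigma>" for w
  proof (rule ccontr)
    assume "w \<notin> \<tau>"
    moreover have w\<sigma>: "w \<in> \<sigma>" using w by (simp add: negpart_def)
    ultimately have "\<beta> w = 0" using \<tau>_eq \<beta>0 by force
    then have "a w > 0" using pos[OF 1 w\<sigma>] by simp
    moreover have "coord \<xi> \<sigma> w = a w"
      by (rule coefficients_unique[OF \<sigma> _ w\<sigma>]) (use a coord[OF fac] in auto)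
    ultimately show False using w by (simp add: negpart_def)
  qed
  then show ?thesis using fac \<tau>_eq by blast
qed

text \<open>Adding a large multiple of the sum of the generators of \<open>\<tau>\<close> to
  \<open>\<xi>\<close> makes all coordinates positive in both facets, and \<open>unique\<close>
  applies to this common point.\<close>

lemma facet_unique:
  assumes gen: "generic \<xi>" and G: "G \<in> facets \<xi>" "negpart \<xi> G \<subseteq> \<tau>" "\<tau> \<subseteq> G"
    and H: "H \<in> facets \<xi>" "negpart \<xi> H \<subseteq> \<tau>" "\<tau> \<subseteq> H"
  shows "G = H"
proof -
  define M where "M K = (\<Sum>w\<in>K. \<bar>coord \<xi> K w\<bar>)" for K
  \<comment> \<open>\<open>N\<close> exceeds the absolute value of every coordinate in either
    facet.\<close>
  define N where "N = M G + M H + 1"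
  define c where "c K w = coord \<xi> K w + (if w \<in> \<tau> then N else 0)" for K w
  have fin: "finite G" "finite H" and \<Gamma>: "G \<in> \<Gamma>" "H \<in> \<Gamma>" using G H facets_subset finite_face by blast+
  have M0: "M K \<ge> 0" for K by (simp add: M_def sum_nonneg)
  have pos: "c K w > 0" if K: "K \<in> facets \<xi>" "negpart \<xi> K \<subseteq> \<tau>" "finite K" "M K < N" and w: "w \<in> K" for K w
  proof (cases "w \<in> \<tau>")
    case True
    have "\<bar>coord \<xi> K w\<bar> \<le> M K" unfolding M_def using K w by (intro member_le_sum) auto
    then show ?thesis using K True by (simp add: c_def)
  next
    case False
    then have "coord \<xi> K w \<ge> 0" using K w by (force simp: negpart_def)
    then show ?thesis using coord_nonzero[OF gen K(1) w] False by (simp add: c_def)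
  qed
  have val: "(\<Sum>w\<in>K. c K w * l w i) = \<xi> i + N * (\<Sum>w\<in>\<tau>. l w i)"
    if K: "K \<in> facets \<xi>" "finite K" "\<tau> \<subseteq> K" and i: "i \<in> V" for K i
  proof -
    have "(\<Sum>w\<in>K. (if w \<in> \<tau> then N else 0) * l w i) = (\<Sum>w\<in>\<tau>. N * l w i)"
      using K by (intro sum.mono_neutral_cong_right) auto
    then show ?thesis using coord[OF K(1) i]
      by (simp add: c_def distrib_right sum.distrib sum_distrib_left)
  qed
  show ?thesis
  proof (rule unique[OF \<Gamma>, of "c G" "c H"])
    show "c G w > 0" if "w \<in> G" for w using pos[OF G(1,2) fin(1) _ that] M0[of H] by (simp add: N_def)
    show "c H w > 0" if "w \<in> H" for w using pos[OF H(1,2) fin(2) _ that] M0[of G] by (simp add: N_def)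
    show "(\<Sum>w\<in>G. c G w * l w i) = (\<Sum>w\<in>H. c H w * l w i)" if "i \<in> V" for i
      using val[of G i] val[of H i] G H fin that by simp
  qed
qed

text \<open>At an index outside \<open>carr \<tau>\<close> the generators of \<open>\<tau>\<close>
  vanish, and the other generators of \<open>G\<close> have nonnegative coefficients.\<close>

lemma negative_directions_subset_carr:
  assumes "G \<in> facets \<xi>" "negpart \<xi> G \<subseteq> \<tau>" "\<tau> \<subseteq> G"
  shows "{i \<in> V. \<xi> i < 0} \<subseteq> carr \<tau>"
proof
  fix i assume "i \<in> {i \<in> V. \<xi> i < 0}"
  then have i: "i \<in> V" "\<xi> i < 0" by auto
  have \<Gamma>: "G \<in> \<Gamma>" using assms facets_subset by blast
  show "i \<in> carr \<tau>"
  proof (rule ccontr)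
    assume ni: "i \<notin> carr \<tau>"
    have "coord \<xi> G w * l w i \<ge> 0" if w: "w \<in> G" for w
    proof (cases "w \<in> \<tau>")
      case True
      then show ?thesis using l_eq_0[OF subface[OF \<Gamma> assms(3)] True i(1) ni] by simp
    next
      case False
      then have "coord \<xi> G w \<ge> 0" using assms(2) w by (force simp: negpart_def)
      then show ?thesis using nonneg[OF \<Gamma> w i(1)] by simp
    qed
    then have "\<xi> i \<ge> 0" unfolding coord[OF assms(1) i(1)] by (rule sum_nonneg)
    with i show False by simp
  qed
qed

text \<open>The intervals cover by \<open>ex_facet\<close>, stay within the index set by
  \<open>negative_directions_subset_carr\<close> and are disjoint by \<open>facet_unique\<close>;
  \<open>eul_interval\<close> evaluates each.\<close>

lemma sum_over_carriers:
  assumes gen: "generic \<xi>" and S: "S = {i \<in> V. \<xi> i < 0}"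
  shows "(\<Sum>\<tau> | \<tau> \<in> \<Gamma> \<and> S \<subseteq> carr \<tau>. [:1, -1:] ^ (card V - card \<tau>) * eul (card \<tau>) (card \<tau>))
       = (\<Sum>\<sigma>\<in>facets \<xi>. eul (card V) (card (negpart \<xi> \<sigma>)))"
proof -
  let ?f = "\<lambda>\<tau>. [:1, -1:] ^ (card V - card \<tau>) * eul (card \<tau>) (card \<tau>)"
  let ?I = "\<lambda>\<sigma>. {\<tau>. negpart \<xi> \<sigma> \<subseteq> \<tau> \<and> \<tau> \<subseteq> \<sigma>}"
  have "{\<tau>. \<tau> \<in> \<Gamma> \<and> S \<subseteq> carr \<tau>} = (\<Union>\<sigma>\<in>facets \<xi>. ?I \<sigma>)"
  proof (intro set_eqI iffI)
    fix \<tau> assume "\<tau> \<in> {\<tau>. \<tau> \<in> \<Gamma> \<and> S \<subseteq> carr \<tau>}"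
    then show "\<tau> \<in> (\<Union>\<sigma>\<in>facets \<xi>. ?I \<sigma>)" using ex_facet[OF gen, of \<tau>] S by auto
  next
    fix \<tau> assume "\<tau> \<in> (\<Union>\<sigma>\<in>facets \<xi>. ?I \<sigma>)"
    then obtain \<sigma> where \<sigma>: "\<sigma> \<in> facets \<xi>" "negpart \<xi> \<sigma> \<subseteq> \<tau>" "\<tau> \<subseteq> \<sigma>" by auto
    then have "\<tau> \<in> \<Gamma>" using facets_subset subface by blast
    then show "\<tau> \<in> {\<tau>. \<tau> \<in> \<Gamma> \<and> S \<subseteq> carr \<tau>}" using negative_directions_subset_carr[OF \<sigma>] S by auto
  qed
  then have "(\<Sum>\<tau> | \<tau> \<in> \<Gamma> \<and> S \<subseteq> carr \<tau>. ?f \<tau>) = (\<Sum>\<sigma>\<in>facets \<xi>. \<Sum>\<tau>\<in>?I \<sigma>. ?f \<tau>)"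
  proof (simp only:, intro sum.UNION_disjoint)
    show "finite (facets \<xi>)" using facets_subset finite_\<Gamma> finite_subset by blast
    show "\<forall>\<sigma>\<in>facets \<xi>. finite (?I \<sigma>)"
      using facets_subset finite_face by (auto intro: finite_subset[of _ "Pow _"])
    show "\<forall>G\<in>facets \<xi>. \<forall>H\<in>facets \<xi>. G \<noteq> H \<longrightarrow> ?I G \<inter> ?I H = {}"
      using facet_unique[OF gen] by blast
  qed
  also have "\<dots> = (\<Sum>\<sigma>\<in>facets \<xi>. eul (card V) (card (negpart \<xi> \<sigma>)))"
  proof (rule sum.cong[OF refl])
    fix \<sigma> assume \<sigma>: "\<sigma> \<in> facets \<xi>"
    then have "finite \<sigma>" using facets_subset finite_face by blast
    then show "(\<Sum>\<tau>\<in>?I \<sigma>. ?f \<tau>) = eul (card V) (card (negpart \<xi> \<sigma>))"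
      using eul_interval[of \<sigma> "negpart \<xi> \<sigma>"] card_facet[OF gen \<sigma>] by (simp add: negpart_def)
  qed
  finally show ?thesis .
qed

text \<open>If all coordinates were negative, no entry of \<open>\<xi>\<close> could be positive; if
  none were, no entry could be negative. Mixed signs thus exclude the two end indices of
  \<open>eul\<close>.\<close>

lemma card_negpart:
  assumes gen: "generic \<xi>" and G: "G \<in> facets \<xi>"
  shows "card (negpart \<xi> G) \<le> card V"
    and "i \<in> V \<Longrightarrow> \<xi> i > 0 \<Longrightarrow> card (negpart \<xi> G) < card V"
    and "i \<in> V \<Longrightarrow> \<xi> i < 0 \<Longrightarrow> card (negpart \<xi> G) \<ge> 1"
proof -
  have \<Gamma>: "G \<in> \<Gamma>" and fin: "finite G" using G facets_subset finite_face by blast+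
  have sub: "negpart \<xi> G \<subseteq> G" by (auto simp: negpart_def)
  show "card (negpart \<xi> G) \<le> card V"
    using card_mono[OF fin sub] card_facet[OF gen G] by simp
  show "card (negpart \<xi> G) < card V" if i: "i \<in> V" "\<xi> i > 0"
  proof -
    have "negpart \<xi> G \<noteq> G"
    proof
      assume eq: "negpart \<xi> G = G"
      have "coord \<xi> G w * l w i \<le> 0" if "w \<in> G" for w
      proof -
        have "coord \<xi> G w < 0" using eq that by (auto simp: negpart_def)
        then show ?thesis using nonneg[OF \<Gamma> that i(1)] by (simp add: mult_le_0_iff)
      qed
      then have "\<xi> i \<le> 0" unfolding coord[OF G i(1)] by (rule sum_nonpos)
      with i show False by simp
    qed
    then show ?thesis using psubset_card_mono[OF fin, of "negpart \<xi> G"] sub card_facet[OF gen G] by auto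
  qed
  show "card (negpart \<xi> G) \<ge> 1" if i: "i \<in> V" "\<xi> i < 0"
  proof -
    have "negpart \<xi> G \<noteq> {}"
    proof
      assume "negpart \<xi> G = {}"
      then have "i \<in> carr {}" using negative_directions_subset_carr[OF G, of "{}"] i by auto
      then show False by (simp add: carr_def)
    qed
    then show ?thesis using finite_subset[OF sub fin] by (simp add: Suc_le_eq card_gt_0_iff)
  qed
qed

text \<open>A face whose cone contains the all-ones vector has full carrier, so
  \<open>ex_facet\<close> applies to it.\<close>

lemma facets_nonempty:
  assumes gen: "generic \<xi>"
  shows "facets \<xi> \<noteq> {}"
proof -
  obtain G a where G: "G \<in> \<Gamma>" "\<forall>i\<in>V. 1 = (\<Sum>w\<in>G. a w * l w i)"
    using cover_positive[of "\<lambda>_. 1"] by fastforce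
  have "V \<subseteq> carr G"
  proof
    fix i assume i: "i \<in> V"
    show "i \<in> carr G"
    proof (rule ccontr)
      assume "i \<notin> carr G"
      then have "(\<Sum>w\<in>G. a w * l w i) = 0" using l_eq_0[OF G(1) _ i] by simp
      then show False using G(2) i by force
    qed
  qed
  then show ?thesis using ex_facet[OF gen G(1)] by blast
qed

section \<open>The local h-polynomial as a sum over faces: expansion, value at 0, degree and
  signs\<close>

definition local_h :: "real poly" where
  "local_h = (\<Sum>G\<in>\<Gamma>. [:0, -1:] ^ (card V - card (carr G)) *
     ([:1, -1:] ^ (card (carr G) - card G) * eul (card G) (card G)))"

text \<open>For negative \<open>x\<close> all coefficients \<open>(- x) ^ (card V - card S)\<close> are positive, so that the sign of
  the local \<open>h\<close>-polynomial is controlled by the polynomials \<open>eul (card V) j\<close>.\<close>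

lemma local_h_expansion:
  "[:1, -1:] ^ card V * local_h = (\<Sum>S\<in>Pow V. [:0, -1:] ^ (card V - card S) *
     (\<Sum>\<tau> | \<tau> \<in> \<Gamma> \<and> S \<subseteq> carr \<tau>. [:1, -1:] ^ (card V - card \<tau>) * eul (card \<tau>) (card \<tau>)))"
proof -
  let ?x = "[:0, -1:] :: real poly" and ?y = "[:1, -1:] :: real poly"
  let ?e = "\<lambda>\<tau>. ?y ^ (card V - card \<tau>) * eul (card \<tau>) (card (\<tau> :: 'w set))"
  have "(\<Sum>S\<in>Pow V. ?x ^ (card V - card S) * (\<Sum>\<tau> | \<tau> \<in> \<Gamma> \<and> S \<subseteq> carr \<tau>. ?e \<tau>))
      = (\<Sum>S\<in>Pow V. \<Sum>\<tau>\<in>\<Gamma>. if S \<subseteq> carr \<tau> then ?x ^ (card V - card S) * ?e \<tau> else 0)"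
    unfolding sum_distrib_left by (intro sum.cong refl sum.inter_filter[OF finite_\<Gamma>])
  also have "\<dots> = (\<Sum>\<tau>\<in>\<Gamma>. \<Sum>S\<in>Pow V. if S \<subseteq> carr \<tau> then ?x ^ (card V - card S) * ?e \<tau> else 0)"
    by (rule sum.swap)
  also have "\<dots> = (\<Sum>\<tau>\<in>\<Gamma>. ?y ^ card V * (?x ^ (card V - card (carr \<tau>)) *
     (?y ^ (card (carr \<tau>) - card \<tau>) * eul (card \<tau>) (card \<tau>))))"
  proof (rule sum.cong[OF refl])
    fix \<tau> assume \<tau>: "\<tau> \<in> \<Gamma>"
    let ?c = "card (carr \<tau>)"
    have c: "?c \<le> card V" using card_mono[OF finite_V carr_subset] .
    have "(\<Sum>S\<in>Pow V. if S \<subseteq> carr \<tau> then ?x ^ (card V - card S) * ?e \<tau> else 0)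
        = (\<Sum>S\<in>{S \<in> Pow V. S \<subseteq> carr \<tau>}. ?x ^ (card V - card S) * ?e \<tau>)"
      by (rule sum.inter_filter[symmetric]) (use finite_V in simp)
    also have "{S \<in> Pow V. S \<subseteq> carr \<tau>} = {S. {} \<subseteq> S \<and> S \<subseteq> carr \<tau>}" using carr_subset by auto
    \<comment> \<open>The powers are arranged for \<open>sum_interval_powers\<close> with bases -x
      and 1, whose sum is 1 - x.\<close>
    also have "(\<Sum>S\<in>{S. {} \<subseteq> S \<and> S \<subseteq> carr \<tau>}. ?x ^ (card V - card S) * ?e \<tau>)
       = (\<Sum>S\<in>{S. {} \<subseteq> S \<and> S \<subseteq> carr \<tau>}. ?x ^ (?c - card S) * 1 ^ (card S - card ({} :: 'v set)) * (?x ^ (card V - ?c) * ?e \<tau>))"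
    proof (rule sum.cong[OF refl])
      fix S assume "S \<in> {S. {} \<subseteq> S \<and> S \<subseteq> carr \<tau>}"
      then have "card S \<le> ?c" using card_mono[OF finite_carr] by auto
      then have "?x ^ (card V - card S) = ?x ^ (?c - card S) * ?x ^ (card V - ?c)"
        using c by (simp flip: power_add)
      then show "?x ^ (card V - card S) * ?e \<tau>
         = ?x ^ (?c - card S) * 1 ^ (card S - card ({} :: 'v set)) * (?x ^ (card V - ?c) * ?e \<tau>)"
        by (simp only: power_one mult.assoc mult_1_left)
    qed
    also have "\<dots> = (1 + ?x) ^ ?c * (?x ^ (card V - ?c) * ?e \<tau>)"
      using sum_interval_powers[of "carr \<tau>" "{}" ?x 1] finite_carr[of \<tau>] by (simp only: flip: sum_distrib_right) simp
    also have "1 + ?x = ?y" by (simp add: one_pCons)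
    also have "?y ^ ?c * (?x ^ (card V - ?c) * ?e \<tau>)
      = (?y ^ ?c * ?y ^ (card V - card \<tau>)) * (?x ^ (card V - ?c) * eul (card \<tau>) (card \<tau>))"
      by (simp only: mult_ac)
    also have "?c + (card V - card \<tau>) = card V + (?c - card \<tau>)"
      using card_le_card_carr[OF \<tau>] c by simp
    then have "?y ^ ?c * ?y ^ (card V - card \<tau>) = ?y ^ card V * ?y ^ (?c - card \<tau>)"
      by (simp only: flip: power_add)
    finally show "(\<Sum>S\<in>Pow V. if S \<subseteq> carr \<tau> then ?x ^ (card V - card S) * ?e \<tau> else 0)
      = ?y ^ card V * (?x ^ (card V - ?c) * (?y ^ (?c - card \<tau>) * eul (card \<tau>) (card \<tau>)))"
      by (simp only: mult_ac)
  qed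
  also have "\<dots> = ?y ^ card V * local_h" unfolding local_h_def by (rule sum_distrib_left[symmetric])
  finally show ?thesis ..
qed

text \<open>A face with proper carrier brings a positive power of -x; a face with full carrier is
  nonempty, and then \<open>eul\<close> itself vanishes at 0.\<close>

lemma poly_local_h_0:
  assumes "V \<noteq> {}"
  shows "poly local_h 0 = 0"
  unfolding local_h_def poly_sum
proof (rule sum.neutral, rule ballI)
  fix G assume G: "G \<in> \<Gamma>"
  show "poly ([:0, -1:] ^ (card V - card (carr G)) *
     ([:1, -1:] ^ (card (carr G) - card G) * eul (card G) (card G))) 0 = 0"
  proof (cases "carr G = V")
    case True
    then have "G \<noteq> {}" using assms by (auto simp: carr_def)
    then have "card G \<noteq> 0" using finite_face[OF G] by simp
    then show ?thesis by (simp add: poly_eul_0)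
  next
    case False
    then have "card (carr G) < card V" using carr_subset[of G] by (intro psubset_card_mono[OF finite_V]) auto
    then show ?thesis by simp
  qed
qed

text \<open>Each summand has degree at most \<open>card V\<close>. Its coefficient there does not
  depend on the carrier, because -x and 1 - x have the same leading coefficient.\<close>

lemma degree_local_h:
  assumes V: "V \<noteq> {}"
  shows "degree local_h < card V"
proof -
  let ?N = "card V"
  let ?c = "\<lambda>G. card (carr G)"
  have N: "?N > 0" using V finite_V by (simp add: card_gt_0_iff)
  have deg: "degree ([:1, -1:] ^ k * eul m m) \<le> k + m" "degree ([:0, -1:] ^ j * ([:1, -1:] ^ k * eul m m)) \<le> j + (k + m)"
    for j k m
  proof -
    show 1: "degree ([:1, -1:] ^ k * eul m m) \<le> k + m"
      by (rule order.trans[OF degree_mult_le]) (use degree_eul[of m m] in \<open>simp add: degree_linear_power\<close>)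
    show "degree ([:0, -1:] ^ j * ([:1, -1:] ^ k * eul m m)) \<le> j + (k + m)"
      by (rule order.trans[OF degree_mult_le]) (use 1 in \<open>simp add: degree_linear_power\<close>)
  qed
  have cf1: "coeff ([:1, -1:] ^ k * eul m m) (k + m) = (-1) ^ k * coeff (eul m m) m" for k m
    by (subst coeff_mult_top) (use degree_eul[of m m] in \<open>simp_all add: degree_linear_power coeff_linear_power\<close>)
  have cf2: "coeff ([:0, -1:] ^ j * ([:1, -1:] ^ k * eul m m)) (j + (k + m)) = (-1) ^ (j + k) * coeff (eul m m) m"
    for j k m
    by (subst coeff_mult_top) (use deg cf1 in \<open>simp_all add: degree_linear_power coeff_linear_power power_add\<close>)
  have N_eq: "?N - ?c G + (?c G - card G + card G) = ?N" "?N - card G + card G = ?N"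
    "?N - ?c G + (?c G - card G) = ?N - card G" if "G \<in> \<Gamma>" for G
    using card_le_card_carr[OF that] card_mono[OF finite_V carr_subset, of G] by auto
  have "degree local_h \<le> ?N" unfolding local_h_def
  proof (rule degree_sum_le[OF finite_\<Gamma>])
    fix G assume "G \<in> \<Gamma>"
    then show "degree ([:0, -1:] ^ (?N - ?c G) * ([:1, -1:] ^ (?c G - card G) * eul (card G) (card G))) \<le> ?N"
      using deg(2)[where j = "?N - ?c G" and k = "?c G - card G" and m = "card G"] N_eq(1) by simp
  qed
  moreover have "coeff local_h ?N = 0"
  proof -
    \<comment> \<open>The case \<open>S = {}\<close> of \<open>sum_over_carriers\<close> describes
      the top coefficient. For a positive \<open>\<xi>\<close> no facet has only negative
      coordinates, so each \<open>eul\<close> involved has degree below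
      \<open>card V\<close>.\<close>
    obtain \<xi> where gen: "generic \<xi>" and sgn: "\<forall>i\<in>V. \<xi> i < 0 \<longleftrightarrow> i \<in> {}" using ex_generic by blast
    have pos: "\<xi> i > 0" if "i \<in> V" for i using gen sgn that unfolding generic_def by force
    have "coeff local_h ?N = (\<Sum>G\<in>\<Gamma>. (-1) ^ (?N - card G) * coeff (eul (card G) (card G)) (card G))"
      unfolding local_h_def coeff_sum
    proof (rule sum.cong[OF refl])
      fix G assume "G \<in> \<Gamma>"
      then show "coeff ([:0, -1:] ^ (?N - ?c G) * ([:1, -1:] ^ (?c G - card G) * eul (card G) (card G))) ?N
          = (-1) ^ (?N - card G) * coeff (eul (card G) (card G)) (card G)"
        using cf2[where j = "?N - ?c G" and k = "?c G - card G" and m = "card G"] N_eq by simp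
    qed
    also have "\<dots> = (\<Sum>G\<in>\<Gamma>. coeff ([:1, -1:] ^ (?N - card G) * eul (card G) (card G)) ?N)"
    proof (rule sum.cong[OF refl])
      fix G assume "G \<in> \<Gamma>"
      then show "(-1) ^ (?N - card G) * coeff (eul (card G) (card G)) (card G)
         = coeff ([:1, -1:] ^ (?N - card G) * eul (card G) (card G)) ?N"
        using cf1[where k = "?N - card G" and m = "card G"] N_eq(2) by simp
    qed
    also have "\<dots> = coeff (\<Sum>\<tau> | \<tau> \<in> \<Gamma> \<and> {} \<subseteq> carr \<tau>. [:1, -1:] ^ (?N - card \<tau>) * eul (card \<tau>) (card \<tau>)) ?N"
      by (simp add: coeff_sum)
    also have "\<dots> = (\<Sum>\<sigma>\<in>facets \<xi>. coeff (eul ?N (card (negpart \<xi> \<sigma>))) ?N)"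
      using sum_over_carriers[OF gen, of "{}"] pos by (subst sum_over_carriers[OF gen]) (force simp: coeff_sum)+
    also have "\<dots> = 0"
    proof (rule sum.neutral, rule ballI)
      fix \<sigma> assume "\<sigma> \<in> facets \<xi>"
      then have "card (negpart \<xi> \<sigma>) < ?N" using card_negpart(2)[OF gen] pos V by blast
      then show "coeff (eul ?N (card (negpart \<xi> \<sigma>))) ?N = 0"
        using degree_eul[of "card (negpart \<xi> \<sigma>)" ?N] by (intro coeff_eq_0) auto
    qed
    finally show ?thesis .
  qed
  ultimately show ?thesis using N
    by (metis degree_0 le_neq_implies_less leading_coeff_0_iff)
qed

theorem eulerian_interlaces_local_h:
  assumes V: "V \<noteq> {}"
  shows "real_rooted local_h \<and> eulerian_poly (card V) \<preceq> local_h"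
proof -
  obtain n where n: "card V = Suc n" using V finite_V by (metis card_gt_0_iff gr0_implies_Suc)
  obtain \<alpha> where \<alpha>: "\<And>i. i < n \<Longrightarrow> \<alpha> i < 0" "\<And>i j. i < j \<Longrightarrow> j < n \<Longrightarrow> \<alpha> j < \<alpha> i"
    and prod: "eul (Suc n) 0 = (\<Prod>i<n. [:- \<alpha> i, 1:])"
    and sgn: "\<And>i. i < n \<Longrightarrow> (-1) ^ i * poly (eul n 0) (\<alpha> i) > 0"
    using eul_0_roots[of n] by blast
  note sign = eul_sign_at_eul_0_root[OF \<alpha>(1) prod sgn]
  let ?s = "\<lambda>S. \<Sum>\<tau> | \<tau> \<in> \<Gamma> \<and> S \<subseteq> carr \<tau>. [:1, -1:] ^ (card V - card \<tau>) * eul (card \<tau>) (card \<tau>)"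
  have s: "\<exists>\<xi>. generic \<xi> \<and> (\<forall>i\<in>V. \<xi> i < 0 \<longleftrightarrow> i \<in> S) \<and>
      ?s S = (\<Sum>\<sigma>\<in>facets \<xi>. eul (Suc n) (card (negpart \<xi> \<sigma>)))" if S: "S \<subseteq> V" for S
  proof -
    obtain \<xi> where \<xi>: "generic \<xi>" "\<forall>i\<in>V. \<xi> i < 0 \<longleftrightarrow> i \<in> S" using ex_generic by blast
    then have "S = {i \<in> V. \<xi> i < 0}" using S by auto
    from sum_over_carriers[OF \<xi>(1) this] show ?thesis using \<xi> n by auto
  qed
  have "(-1) ^ Suc i * poly local_h (\<alpha> i) > 0" if i: "i < n" for i
  proof -
    let ?x = "\<alpha> i"
    have nonneg: "(-1) ^ Suc i * poly (?s S) ?x \<ge> 0" if S: "S \<subseteq> V" for S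
    proof -
      obtain \<xi> where gen: "generic \<xi>" and eq: "?s S = (\<Sum>\<sigma>\<in>facets \<xi>. eul (Suc n) (card (negpart \<xi> \<sigma>)))"
        using s[OF S] by blast
      have "(\<Sum>\<sigma>\<in>facets \<xi>. (-1) ^ Suc i * poly (eul (Suc n) (card (negpart \<xi> \<sigma>))) ?x) \<ge> 0"
        by (rule sum_nonneg) (use sign(1) i card_negpart(1)[OF gen] n in auto)
      then show ?thesis unfolding eq poly_sum sum_distrib_left .
    qed
    \<comment> \<open>Since \<open>i < n\<close> and \<open>card V = Suc n\<close>, there are two
      vertices. A vector negative at \<open>a\<close> and positive at \<open>b\<close> involves only
      inner indices of \<open>eul\<close>, where the sign is strict.\<close>
    obtain a where a: "a \<in> V" using V by blast
    have "V \<noteq> {a}" using n i by auto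
    then obtain b where b: "b \<in> V" "b \<noteq> a" using a by blast
    have pos: "(-1) ^ Suc i * poly (?s {a}) ?x > 0"
    proof -
      obtain \<xi> where gen: "generic \<xi>" and neg: "\<forall>i\<in>V. \<xi> i < 0 \<longleftrightarrow> i \<in> {a}"
        and eq: "?s {a} = (\<Sum>\<sigma>\<in>facets \<xi>. eul (Suc n) (card (negpart \<xi> \<sigma>)))"
        using s[of "{a}"] a by blast
      have "\<xi> a < 0" using neg a by simp
      have "\<xi> b > 0" using neg b gen unfolding generic_def by force
      have "(\<Sum>\<sigma>\<in>facets \<xi>. (-1) ^ Suc i * poly (eul (Suc n) (card (negpart \<xi> \<sigma>))) ?x) > 0"
      proof (rule sum_pos)
        show "finite (facets \<xi>)" using facets_subset finite_\<Gamma> finite_subset by blast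
        show "facets \<xi> \<noteq> {}" by (rule facets_nonempty[OF gen])
        fix \<sigma> assume \<sigma>: "\<sigma> \<in> facets \<xi>"
        show "(-1) ^ Suc i * poly (eul (Suc n) (card (negpart \<xi> \<sigma>))) ?x > 0"
          using sign(2)[OF _ _ i, of "card (negpart \<xi> \<sigma>)"] card_negpart(2)[OF gen \<sigma> b(1) \<open>\<xi> b > 0\<close>]
            card_negpart(3)[OF gen \<sigma> a \<open>\<xi> a < 0\<close>] n by simp
      qed
      then show ?thesis unfolding eq poly_sum sum_distrib_left .
    qed
    have "(\<Sum>S\<in>Pow V. (- ?x) ^ (card V - card S) * ((-1) ^ Suc i * poly (?s S) ?x)) > 0"
    proof (rule sum_pos2[of _ "{a}"])
      show "(- ?x) ^ (card V - card {a}) * ((-1) ^ Suc i * poly (?s {a}) ?x) > 0"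
        by (rule mult_pos_pos[OF zero_less_power pos]) (use \<alpha>(1)[OF i] in simp)
      fix S assume "S \<in> Pow V"
      then have "S \<subseteq> V" by simp
      then show "(- ?x) ^ (card V - card S) * ((-1) ^ Suc i * poly (?s S) ?x) \<ge> 0"
        by (rule mult_nonneg_nonneg[OF zero_le_power nonneg, rotated]) (use \<alpha>(1)[OF i] in simp)
    qed (use a finite_V in auto)
    also have "(\<Sum>S\<in>Pow V. (- ?x) ^ (card V - card S) * ((-1) ^ Suc i * poly (?s S) ?x))
      = (-1) ^ Suc i * poly ([:1, -1:] ^ card V * local_h) ?x"
      unfolding local_h_expansion poly_sum[of _ "Pow V"] sum_distrib_left[of _ _ "Pow V"]
      by (rule sum.cong[OF refl]) (simp only: poly_mult poly_power mult_ac, simp)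
    also have "\<dots> = (1 - ?x) ^ card V * ((-1) ^ Suc i * poly local_h ?x)" by simp
    finally show ?thesis by (rule zero_less_mult_pos) (use \<alpha>(1)[OF i] in simp)
  qed
  then have "real_rooted local_h \<and> (\<Prod>i<n. [:- \<alpha> i, 1:]) \<preceq> local_h"
    using poly_local_h_0[OF V] degree_local_h[OF V] n by (intro eulerian_interlaces[OF \<alpha>]) auto
  then show ?thesis unfolding eulerian_poly_eq n prod .
qed

end

section \<open>Barycentric subdivisions\<close>

text \<open>The union of a nonempty chain is its largest member. For the empty chain it is the empty
  face, so that chains can be sorted uniformly by their unions.\<close>

lemma sdD:
  assumes "abstract_complex K" "c \<in> sd K"
  shows "finite c" "{} \<notin> c" "c \<subseteq> K" "\<And>A B. A \<in> c \<Longrightarrow> B \<in> c \<Longrightarrow> A \<subseteq> B \<or> B \<subseteq> A"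
    "c \<noteq> {} \<Longrightarrow> \<Union>c \<in> c" "\<Union>c \<in> K"
proof -
  show c: "c \<subseteq> K" "{} \<notin> c" "\<And>A B. A \<in> c \<Longrightarrow> B \<in> c \<Longrightarrow> A \<subseteq> B \<or> B \<subseteq> A"
    using assms(2) by (auto simp: sd_def chains_def chain_subset_def)
  show fin: "finite c" using assms c finite_subset by (auto simp: abstract_complex_def)
  show U: "\<Union>c \<in> c" if "c \<noteq> {}"
    by (rule Union_in_chain[OF fin that, of K]) (use c in \<open>auto simp: subset.chain_def\<close>)
  show "\<Union>c \<in> K" using U c assms(1) by (cases "c = {}") (auto simp: abstract_complex_def)
qed

lemma finite_sd:
  assumes "abstract_complex K"
  shows "finite (sd K)"
  by (rule finite_subset[of _ "Pow K"]) (use assms in \<open>auto simp: sd_def chains_def abstract_complex_def\<close>)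

text \<open>The members of a chain have distinct sizes between 1 and the size of the union.\<close>

lemma card_chain_le:
  assumes K: "abstract_complex K" and c: "c \<in> sd K"
  shows "card c \<le> card (\<Union>c)"
proof -
  note D = sdD[OF K c]
  have fin: "finite A" if "A \<in> K" for A using K that by (simp add: abstract_complex_def)
  have "card c = card (card ` c)"
  proof (rule card_image[symmetric], rule inj_onI)
    fix A B assume AB: "A \<in> c" "B \<in> c" "card A = card B"
    then have "finite A" "finite B" using D(3) fin by auto
    then show "A = B" using D(4)[OF AB(1,2)] AB(3) card_subset_eq by metis
  qed
  also have "\<dots> \<le> card {1..card (\<Union>c)}"
  proof (rule card_mono)
    show "card ` c \<subseteq> {1..card (\<Union>c)}"
    proof clarify
      fix A assume A: "A \<in> c"
      then have "finite A" "A \<noteq> {}" using D fin by auto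
      moreover have "A \<subseteq> \<Union>c" using A by auto
      ultimately show "card A \<in> {1..card (\<Union>c)}"
        using card_mono[OF fin[OF D(6)], of A] by (simp add: Suc_le_eq card_gt_0_iff)
    qed
  qed simp
  finally show ?thesis by simp
qed

lemma insert_top_chain:
  assumes K: "abstract_complex K" and c: "c \<in> sd K" and G: "G \<in> K" "\<Union>c \<subset> G"
  shows "insert G c \<in> sd K" "\<Union>(insert G c) = G" "G \<notin> c"
proof -
  have below: "A \<subseteq> G" if "A \<in> c" for A using that G(2) by blast
  have "G \<noteq> {}" using G(2) by auto
  then show "insert G c \<in> sd K"
    using c G(1) below unfolding sd_def chains_def chain_subset_def by blast
  show "\<Union>(insert G c) = G" "G \<notin> c" using G(2) by auto
qed

lemma chains_with_top:
  assumes K: "abstract_complex K" and G: "G \<in> K" "G \<noteq> {}"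
  shows "{c \<in> sd K. \<Union>c = G} = insert G ` {c \<in> sd K. \<Union>c \<subset> G}"
proof (intro subset_antisym subsetI)
  fix c assume "c \<in> {c \<in> sd K. \<Union>c = G}"
  then have c: "c \<in> sd K" "\<Union>c = G" by auto
  note D = sdD[OF K c(1)]
  have Gc: "G \<in> c" using D(5) c(2) G by auto
  have c': "c - {G} \<in> sd K" using c(1) by (auto simp: sd_def chains_def chain_subset_def)
  have "\<Union>(c - {G}) \<subset> G"
  proof (cases "c - {G} = {}")
    case True
    then show ?thesis using G by auto
  next
    case False
    then have "\<Union>(c - {G}) \<in> c - {G}" by (rule sdD(5)[OF K c'])
    then show ?thesis using c(2) by blast
  qed
  then show "c \<in> insert G ` {c \<in> sd K. \<Union>c \<subset> G}"
    using c' Gc by (intro image_eqI[of _ _ "c - {G}"]) auto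
next
  fix c assume "c \<in> insert G ` {c \<in> sd K. \<Union>c \<subset> G}"
  then show "c \<in> {c \<in> sd K. \<Union>c = G}" using insert_top_chain[OF K _ G(1)] by auto
qed

text \<open>Remove one vertex at a time. Such chains attain the dimension needed in
  \<open>h_poly_restricted_sd\<close>.\<close>

lemma ex_full_chain:
  assumes K: "abstract_complex K"
  shows "G \<in> K \<Longrightarrow> \<exists>c\<in>sd K. \<Union>c = G \<and> card c = card G"
proof (induction "card G" arbitrary: G)
  case 0
  then have "G = {}" using K by (auto simp: abstract_complex_def)
  then show ?case by (intro bexI[of _ "{}"]) (auto simp: sd_def chains_def chain_subset_def)
next
  case (Suc n)
  then obtain v where v: "v \<in> G" by fastforce
  have fin: "finite G" and G': "G - {v} \<in> K" using Suc.prems K by (auto simp: abstract_complex_def)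
  have "n = card (G - {v})" using Suc.hyps(2) v fin by simp
  then obtain c where c: "c \<in> sd K" "\<Union>c = G - {v}" "card c = card (G - {v})"
    using Suc.hyps(1)[OF _ G'] by metis
  have sub: "\<Union>c \<subset> G" using c(2) v by auto
  note I = insert_top_chain[OF K c(1) Suc.prems sub]
  have "card (insert G c) = card G"
    using I(3) sdD(1)[OF K c(1)] c(3) card_Suc_Diff1[OF fin v] by simp
  with I(1,2) show ?case by blast
qed

text \<open>Removing the top \<open>G\<close> and grouping the remaining chains by their own union
  yields the recursion of \<open>eul_proper_subsets\<close>.\<close>

lemma sum_chains_with_top:
  assumes K: "abstract_complex K"
  shows "G \<in> K \<Longrightarrow> (\<Sum>c | c \<in> sd K \<and> \<Union>c = G. [:0, 1:] ^ card c * [:1, -1:] ^ (card G - card c))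
    = eul (card G) (card G)"
proof (induction "card G" arbitrary: G rule: less_induct)
  case less
  have finG: "finite G" using K less.prems by (simp add: abstract_complex_def)
  let ?w = "\<lambda>N c. [:0, 1:] ^ card c * [:1, -1:] ^ (N - card c) :: real poly"
  show ?case
  proof (cases "G = {}")
    case True
    have "{c. c \<in> sd K \<and> \<Union>c = {}} = {{}}"
    proof (intro subset_antisym subsetI)
      fix c assume "c \<in> {c. c \<in> sd K \<and> \<Union>c = {}}"
      then show "c \<in> {{}}" using sdD(2)[OF K] by auto
    qed (auto simp: sd_def chains_def chain_subset_def)
    then show ?thesis using True by simp
  next
    case False
    have inj: "inj_on (insert G) {c \<in> sd K. \<Union>c \<subset> G}"
    proof (rule inj_onI)
      fix c c' assume *: "c \<in> {c \<in> sd K. \<Union>c \<subset> G}" "c' \<in> {c \<in> sd K. \<Union>c \<subset> G}" "insert G c = insert G c'"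
      then have "G \<notin> c" "G \<notin> c'" by auto
      with *(3) show "c = c'" by (metis insert_ident)
    qed
    have "(\<Sum>c | c \<in> sd K \<and> \<Union>c = G. ?w (card G) c) = (\<Sum>c\<in>{c \<in> sd K. \<Union>c \<subset> G}. ?w (card G) (insert G c))"
      unfolding chains_with_top[OF K less.prems False] by (simp only: sum.reindex[OF inj] o_def)
    also have "\<dots> = (\<Sum>c\<in>{c \<in> sd K. \<Union>c \<subset> G}. [:0, 1:] * ([:1, -1:] ^ (card G - 1 - card (\<Union>c)) * ?w (card (\<Union>c)) c))"
    proof (rule sum.cong[OF refl])
      fix c assume "c \<in> {c \<in> sd K. \<Union>c \<subset> G}"
      then have c: "c \<in> sd K" "\<Union>c \<subset> G" by auto
      have "card (\<Union>c) < card G" by (rule psubset_card_mono[OF finG c(2)])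
      \<comment> \<open>The removed top accounts for one unit; the rest of the exponent splits at
        the size of the next union.\<close>
      then have e: "card G - Suc (card c) = (card G - 1 - card (\<Union>c)) + (card (\<Union>c) - card c)"
        using card_chain_le[OF K c(1)] by simp
      have "card (insert G c) = Suc (card c)"
        using insert_top_chain(3)[OF K c(1) less.prems c(2)] sdD(1)[OF K c(1)] by simp
      then show "?w (card G) (insert G c)
          = [:0, 1:] * ([:1, -1:] ^ (card G - 1 - card (\<Union>c)) * ?w (card (\<Union>c)) c)"
        by (simp only: e power_add power_Suc mult_ac)
    qed
    also have "\<dots> = (\<Sum>H\<in>{H. H \<subset> G}. \<Sum>c\<in>{c \<in> {c \<in> sd K. \<Union>c \<subset> G}. \<Union>c = H}.
        [:0, 1:] * ([:1, -1:] ^ (card G - 1 - card (\<Union>c)) * ?w (card (\<Union>c)) c))"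
      by (rule sum.group[symmetric]) (use finite_sd[OF K] finG in \<open>auto intro: finite_subset[of _ "Pow G"]\<close>)
    also have "\<dots> = (\<Sum>H\<in>{H. H \<subset> G}. [:0, 1:] * ([:1, -1:] ^ (card G - 1 - card H) * eul (card H) (card H)))"
    proof (rule sum.cong[OF refl])
      fix H assume "H \<in> {H. H \<subset> G}"
      then have H: "H \<subset> G" by simp
      have HK: "H \<in> K" using H less.prems K by (auto simp: abstract_complex_def)
      have "{c \<in> {c \<in> sd K. \<Union>c \<subset> G}. \<Union>c = H} = {c. c \<in> sd K \<and> \<Union>c = H}" using H by auto
      then have "(\<Sum>c\<in>{c \<in> {c \<in> sd K. \<Union>c \<subset> G}. \<Union>c = H}.
          [:0, 1:] * ([:1, -1:] ^ (card G - 1 - card (\<Union>c)) * ?w (card (\<Union>c)) c))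
        = (\<Sum>c | c \<in> sd K \<and> \<Union>c = H. [:0, 1:] * ([:1, -1:] ^ (card G - 1 - card H) * ?w (card H) c))"
        by (intro sum.cong) auto
      also have "\<dots> = [:0, 1:] * ([:1, -1:] ^ (card G - 1 - card H) * eul (card H) (card H))"
        unfolding less.hyps[OF psubset_card_mono[OF finG H] HK, symmetric] by (simp only: sum_distrib_left)
      finally show "(\<Sum>c\<in>{c \<in> {c \<in> sd K. \<Union>c \<subset> G}. \<Union>c = H}.
          [:0, 1:] * ([:1, -1:] ^ (card G - 1 - card (\<Union>c)) * ?w (card (\<Union>c)) c))
        = [:0, 1:] * ([:1, -1:] ^ (card G - 1 - card H) * eul (card H) (card H))" .
    qed
    also have "\<dots> = eul (card G) (card G)"
      unfolding eul_proper_subsets[OF finG False] by (simp only: sum_distrib_left)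
    finally show ?thesis .
  qed
qed

section \<open>h-polynomials of restrictions of the barycentric subdivision\<close>

lemma h_poly_eq_sum:
  assumes "finite K"
  shows "h_poly K = (\<Sum>F\<in>K. [:0, 1:] ^ card F * [:1, -1:] ^ (Max (card ` K) - card F))"
proof -
  define d where "d = Max (card ` K)"
  have "(\<Sum>F\<in>K. [:0, 1:] ^ card F * [:1, -1:] ^ (d - card F))
     = (\<Sum>i\<le>d. \<Sum>F\<in>{F \<in> K. card F = i}. [:0, 1:] ^ card F * [:1, -1:] ^ (d - card F) :: real poly)"
    by (rule sum.group[symmetric]) (use assms in \<open>auto simp: d_def\<close>)
  also have "\<dots> = (\<Sum>i\<le>d. of_nat (card {F \<in> K. card F = i}) * [:0, 1:] ^ i * [:1, -1:] ^ (d - i))"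
  proof (rule sum.cong[OF refl])
    fix i
    have "(\<Sum>F\<in>{F \<in> K. card F = i}. [:0, 1:] ^ card F * [:1, -1:] ^ (d - card F))
        = (\<Sum>F\<in>{F \<in> K. card F = i}. [:0, 1:] ^ i * [:1, -1:] ^ (d - i) :: real poly)"
      by (rule sum.cong) auto
    then show "(\<Sum>F\<in>{F \<in> K. card F = i}. [:0, 1:] ^ card F * [:1, -1:] ^ (d - card F))
        = (of_nat (card {F \<in> K. card F = i}) * [:0, 1:] ^ i * [:1, -1:] ^ (d - i) :: real poly)"
      by (simp only: sum_constant mult.assoc)
  qed
  finally show ?thesis unfolding h_poly_def Let_def d_def[symmetric] ..
qed

context cone_subdivision
begin

text \<open>Faces with carrier in \<open>F\<close> vanish in the coordinates outside
  \<open>F\<close>, so linear relations over \<open>F\<close> extend to \<open>V\<close>.\<close>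

lemma restrict_face:
  assumes F: "F \<subseteq> V"
  shows "cone_subdivision F {G \<in> \<Gamma>. carr G \<subseteq> F} l"
proof
  show "finite F" using F finite_V finite_subset by blast
  have mono: "carr H \<subseteq> carr G" if "H \<subseteq> G" for G H using that by (auto simp: carr_def)
  show "abstract_complex {G \<in> \<Gamma>. carr G \<subseteq> F}"
    unfolding abstract_complex_def
  proof (intro conjI ballI allI impI)
    show "{} \<in> {G \<in> \<Gamma>. carr G \<subseteq> F}" using empty_in by (auto simp: carr_def)
    fix G H assume "G \<in> {G \<in> \<Gamma>. carr G \<subseteq> F}" "H \<subseteq> G"
    then show "H \<in> {G \<in> \<Gamma>. carr G \<subseteq> F}" using subface mono by blast
  qed (use finite_\<Gamma> finite_face in auto)
  show "0 \<le> l w i" if "G \<in> {G \<in> \<Gamma>. carr G \<subseteq> F}" "w \<in> G" "i \<in> F" for G w i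
    using nonneg that F by blast
  have zero: "(\<Sum>w\<in>G. a w * l w i) = 0" if "G \<in> {G \<in> \<Gamma>. carr G \<subseteq> F}" "i \<in> V" "i \<notin> F" for G a i
    by (rule sum.neutral) (use that l_eq_0[of G _ i] in auto)
  show "a w = 0" if G: "G \<in> {G \<in> \<Gamma>. carr G \<subseteq> F}" and s: "\<And>i. i \<in> F \<Longrightarrow> (\<Sum>w\<in>G. a w * l w i) = 0" and w: "w \<in> G"
    for G a w
  proof (rule indep[OF _ _ w])
    show "(\<Sum>w\<in>G. a w * l w i) = 0" if "i \<in> V" for i using s zero[OF G that] by blast
  qed (use G in simp)
  show "G = H" if G: "G \<in> {G \<in> \<Gamma>. carr G \<subseteq> F}" and H: "H \<in> {G \<in> \<Gamma>. carr G \<subseteq> F}"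
    and a: "\<And>w. w \<in> G \<Longrightarrow> a w > 0" and b: "\<And>w. w \<in> H \<Longrightarrow> b w > 0"
    and s: "\<And>i. i \<in> F \<Longrightarrow> (\<Sum>w\<in>G. a w * l w i) = (\<Sum>w\<in>H. b w * l w i)" for G H a b
  proof (rule unique[of G H a b])
    show "(\<Sum>w\<in>G. a w * l w i) = (\<Sum>w\<in>H. b w * l w i)" if "i \<in> V" for i
      using s zero[OF G that, of a] zero[OF H that, of b] by (cases "i \<in> F") auto
  qed (use G H a b in auto)
  show "\<exists>G\<in>{G \<in> \<Gamma>. carr G \<subseteq> F}. \<exists>a. (\<forall>w\<in>G. a w \<ge> 0) \<and> (\<forall>i\<in>F. \<xi> i = (\<Sum>w\<in>G. a w * l w i))"
    if \<xi>: "\<And>i. i \<in> F \<Longrightarrow> \<xi> i \<ge> 0" for \<xi>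
  proof -
    \<comment> \<open>The vector is extended by 0. Strictly positive coefficients force every
      generator used to vanish outside \<open>F\<close>.\<close>
    have "\<exists>G\<in>\<Gamma>. \<exists>a. (\<forall>w\<in>G. a w > 0) \<and> (\<forall>i\<in>V. (if i \<in> F then \<xi> i else 0) = (\<Sum>w\<in>G. a w * l w i))"
      by (rule cover_positive) (use \<xi> in simp)
    then obtain G a where G: "G \<in> \<Gamma>" "\<forall>w\<in>G. a w > 0"
      and a: "\<forall>i\<in>V. (if i \<in> F then \<xi> i else 0) = (\<Sum>w\<in>G. a w * l w i)" by blast
    have "carr G \<subseteq> F"
    proof
      fix i assume "i \<in> carr G"
      then obtain w where w: "w \<in> G" "l w i > 0" and i: "i \<in> V" by (auto simp: carr_def)
      have "(\<Sum>w\<in>G. a w * l w i) > 0"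
        by (rule sum_pos2[OF finite_face[OF G(1)] w(1)]) (use G w i nonneg[OF G(1)] in \<open>auto intro: less_imp_le\<close>)
      then show "i \<in> F" using a i by (metis less_irrefl)
    qed
    moreover have "\<xi> i = (\<Sum>w\<in>G. a w * l w i)" if "i \<in> F" for i
      using bspec[OF a, of i] that F by auto
    ultimately show ?thesis using G by (intro bexI[of _ G] exI[of _ a]) (auto intro: less_imp_le)
  qed
qed

text \<open>Any facet of a generic vector in the restricted subdivision will do.\<close>

lemma ex_full_face:
  assumes F: "F \<subseteq> V"
  shows "\<exists>G\<in>\<Gamma>. carr G \<subseteq> F \<and> card G = card F"
proof -
  interpret R: cone_subdivision F "{G \<in> \<Gamma>. carr G \<subseteq> F}" l by (rule restrict_face[OF F])
  obtain \<xi> where gen: "R.generic \<xi>" using R.ex_generic by blast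
  then obtain G where "G \<in> R.facets \<xi>" using R.facets_nonempty by blast
  then show ?thesis using R.card_facet[OF gen] R.facets_subset by blast
qed

text \<open>The chains are grouped by their union, and each group is evaluated by
  \<open>sum_chains_with_top\<close>.\<close>

lemma h_poly_restricted_sd:
  assumes F: "F \<subseteq> V"
  shows "h_poly {c \<in> sd \<Gamma>. carr (\<Union>c) \<subseteq> F} = (\<Sum>G | G \<in> \<Gamma> \<and> carr G \<subseteq> F. [:1, -1:] ^ (card F - card G) * eul (card G) (card G))"
proof -
  let ?K = "{c \<in> sd \<Gamma>. carr (\<Union>c) \<subseteq> F}"
  have fin: "finite ?K" using finite_sd[OF complex] by simp
  have finF: "finite F" using F finite_V finite_subset by blast
  have le: "card G \<le> card F" if "G \<in> \<Gamma>" "carr G \<subseteq> F" for G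
    using card_le_card_carr[OF that(1)] card_mono[OF finF that(2)] by simp
  \<comment> \<open>A full chain below a full face shows that the exponent in the h-polynomial is
    \<open>card F\<close>.\<close>
  have d: "Max (card ` ?K) = card F"
  proof (rule Max_eqI)
    show "finite (card ` ?K)" using fin by simp
    show "y \<le> card F" if "y \<in> card ` ?K" for y
      using that card_chain_le[OF complex] le sdD(6)[OF complex] by (auto intro: order.trans)
    obtain G where G: "G \<in> \<Gamma>" "carr G \<subseteq> F" "card G = card F" using ex_full_face[OF F] by blast
    obtain c where "c \<in> sd \<Gamma>" "\<Union>c = G" "card c = card G" using ex_full_chain[OF complex G(1)] by blast
    then show "card F \<in> card ` ?K" using G by (intro image_eqI[of _ _ c]) auto
  qed
  have "h_poly ?K = (\<Sum>c\<in>?K. [:0, 1:] ^ card c * [:1, -1:] ^ (card F - card c))"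
    using h_poly_eq_sum[OF fin] d by simp
  also have "\<dots> = (\<Sum>G\<in>{G. G \<in> \<Gamma> \<and> carr G \<subseteq> F}. \<Sum>c\<in>{c \<in> ?K. \<Union>c = G}. [:0, 1:] ^ card c * [:1, -1:] ^ (card F - card c))"
    by (rule sum.group[symmetric]) (use fin finite_\<Gamma> sdD(6)[OF complex] in auto)
  also have "\<dots> = (\<Sum>G | G \<in> \<Gamma> \<and> carr G \<subseteq> F. [:1, -1:] ^ (card F - card G) * eul (card G) (card G))"
  proof (rule sum.cong[OF refl])
    fix G assume "G \<in> {G. G \<in> \<Gamma> \<and> carr G \<subseteq> F}"
    then have G: "G \<in> \<Gamma>" "carr G \<subseteq> F" by auto
    have "(\<Sum>c\<in>{c \<in> ?K. \<Union>c = G}. [:0, 1:] ^ card c * [:1, -1:] ^ (card F - card c))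
       = (\<Sum>c | c \<in> sd \<Gamma> \<and> \<Union>c = G. [:1, -1:] ^ (card F - card G) * ([:0, 1:] ^ card c * [:1, -1:] ^ (card G - card c)) :: real poly)"
    proof (rule sum.cong)
      fix c assume "c \<in> {c. c \<in> sd \<Gamma> \<and> \<Union>c = G}"
      then have "card c \<le> card G" using card_chain_le[OF complex] by blast
      then have "card F - card c = (card F - card G) + (card G - card c)" using le[OF G] by simp
      then show "[:0, 1:] ^ card c * [:1, -1:] ^ (card F - card c)
        = ([:1, -1:] ^ (card F - card G) * ([:0, 1:] ^ card c * [:1, -1:] ^ (card G - card c)) :: real poly)"
        by (simp only: power_add mult_ac)
    qed (use G in auto)
    also have "\<dots> = [:1, -1:] ^ (card F - card G) * eul (card G) (card G)"
      unfolding sum_chains_with_top[OF complex G(1), symmetric] by (simp only: sum_distrib_left)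
    finally show "(\<Sum>c\<in>{c \<in> ?K. \<Union>c = G}. [:0, 1:] ^ card c * [:1, -1:] ^ (card F - card c))
       = [:1, -1:] ^ (card F - card G) * eul (card G) (card G)" .
  qed
  finally show ?thesis .
qed

text \<open>After exchanging the sums, the sets \<open>F\<close> between the carrier of a face and
  \<open>V\<close> contribute a binomial sum with bases -1 and 1 - x. The geometry enters only
  through the hypothesis on restrictions.\<close>

lemma local_h_poly_sd:
  assumes restrict: "\<And>F. F \<subseteq> V \<Longrightarrow> restrict_to \<theta> (sd \<Gamma>) \<psi> (Pow V) F = {c \<in> sd \<Gamma>. carr (\<Union>c) \<subseteq> F}"
  shows "local_h_poly \<theta> (sd \<Gamma>) \<psi> V = local_h"
proof -
  let ?y = "[:1, -1:] :: real poly"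
  let ?t = "\<lambda>F G. (- 1) ^ (card V - card (F :: 'v set)) * (?y ^ (card F - card G) * eul (card G) (card (G :: 'w set)))"
  have "local_h_poly \<theta> (sd \<Gamma>) \<psi> V = (\<Sum>F\<in>Pow V. \<Sum>G | G \<in> \<Gamma> \<and> carr G \<subseteq> F. ?t F G)"
    unfolding local_h_poly_def
    by (rule sum.cong[OF refl]) (simp only: Pow_iff restrict h_poly_restricted_sd sum_distrib_left)
  also have "\<dots> = (\<Sum>F\<in>Pow V. \<Sum>G\<in>\<Gamma>. if carr G \<subseteq> F then ?t F G else 0)"
    by (intro sum.cong refl sum.inter_filter[OF finite_\<Gamma>])
  also have "\<dots> = (\<Sum>G\<in>\<Gamma>. \<Sum>F\<in>Pow V. if carr G \<subseteq> F then ?t F G else 0)"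
    by (rule sum.swap)
  also have "\<dots> = local_h" unfolding local_h_def
  proof (rule sum.cong[OF refl])
    fix G assume G: "G \<in> \<Gamma>"
    let ?c = "card (carr G)"
    have "(\<Sum>F\<in>Pow V. if carr G \<subseteq> F then ?t F G else 0) = (\<Sum>F\<in>{F \<in> Pow V. carr G \<subseteq> F}. ?t F G)"
      by (rule sum.inter_filter[symmetric]) (use finite_V in simp)
    also have "{F \<in> Pow V. carr G \<subseteq> F} = {F. carr G \<subseteq> F \<and> F \<subseteq> V}" by auto
    also have "(\<Sum>F\<in>{F. carr G \<subseteq> F \<and> F \<subseteq> V}. ?t F G) = (\<Sum>F\<in>{F. carr G \<subseteq> F \<and> F \<subseteq> V}.
        (- 1) ^ (card V - card F) * ?y ^ (card F - ?c) * (?y ^ (?c - card G) * eul (card G) (card G)))"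
    proof (rule sum.cong[OF refl])
      fix F assume "F \<in> {F. carr G \<subseteq> F \<and> F \<subseteq> V}"
      then have F: "carr G \<subseteq> F" "finite F" using finite_V finite_subset by auto
      then have "card F - card G = (card F - ?c) + (?c - card G)"
        using card_mono[OF F(2,1)] card_le_card_carr[OF G] by simp
      then show "?t F G = (- 1) ^ (card V - card F) * ?y ^ (card F - ?c) * (?y ^ (?c - card G) * eul (card G) (card G))"
        by (simp only: power_add mult_ac)
    qed
    also have "\<dots> = (?y + (- 1)) ^ (card V - ?c) * (?y ^ (?c - card G) * eul (card G) (card G))"
      unfolding sum_interval_powers[OF finite_V carr_subset, symmetric] by (simp only: sum_distrib_right)
    also have "?y + (- 1) = [:0, -1:]" by (simp add: one_pCons)
    finally show "(\<Sum>F\<in>Pow V. if carr G \<subseteq> F then ?t F G else 0)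
      = [:0, -1:] ^ (card V - ?c) * (?y ^ (?c - card G) * eul (card G) (card G))" .
  qed
  finally show ?thesis .
qed

end


section \<open>Barycentric coordinates\<close>

locale affine_simplex =
  fixes V :: "'v set" and \<psi> :: "'v \<Rightarrow> 'e::euclidean_space"
  assumes finite_V: "finite V" and inj: "inj_on \<psi> V" and indep: "\<not> affine_dependent (\<psi> ` V)"
begin

lemma coefficients_zero:
  assumes "(\<Sum>i\<in>V. u i) = 0" "(\<Sum>i\<in>V. u i *\<^sub>R \<psi> i) = 0" "i \<in> V"
  shows "u i = 0"
proof (rule ccontr)
  assume "u i \<noteq> 0"
  define w where "w = u \<circ> inv_into V \<psi>"
  have w: "w (\<psi> j) = u j" if "j \<in> V" for j using inj that by (simp add: w_def)
  have "sum w (\<psi> ` V) = 0" "(\<Sum>v\<in>\<psi> ` V. w v *\<^sub>R v) = 0"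
    using assms(1,2) w by (simp_all add: sum.reindex[OF inj])
  moreover have "\<exists>v\<in>\<psi> ` V. w v \<noteq> 0" using w assms(3) \<open>u i \<noteq> 0\<close> by auto
  ultimately have "affine_dependent (\<psi> ` V)"
    using affine_dependent_explicit_finite[of "\<psi> ` V"] finite_V by blast
  with indep show False ..
qed

lemma coefficients_eq:
  assumes "(\<Sum>i\<in>V. u i) = (\<Sum>i\<in>V. v i)" "(\<Sum>i\<in>V. u i *\<^sub>R \<psi> i) = (\<Sum>i\<in>V. v i *\<^sub>R \<psi> i)" "i \<in> V"
  shows "u i = v i"
  using coefficients_zero[of "\<lambda>i. u i - v i" i] assms by (simp add: sum_subtractf scaleR_left_diff_distrib)

lemma convex_hull_iff:
  "x \<in> convex hull (\<psi> ` V) \<longleftrightarrow> (\<exists>u. (\<forall>i\<in>V. 0 \<le> u i) \<and> (\<Sum>i\<in>V. u i) = 1 \<and> (\<Sum>i\<in>V. u i *\<^sub>R \<psi> i) = x)"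
proof
  assume "x \<in> convex hull (\<psi> ` V)"
  then obtain w where "\<forall>v\<in>\<psi> ` V. 0 \<le> w v" "sum w (\<psi> ` V) = 1" "(\<Sum>v\<in>\<psi> ` V. w v *\<^sub>R v) = x"
    using convex_hull_finite[of "\<psi> ` V"] finite_V by auto
  then show "\<exists>u. (\<forall>i\<in>V. 0 \<le> u i) \<and> (\<Sum>i\<in>V. u i) = 1 \<and> (\<Sum>i\<in>V. u i *\<^sub>R \<psi> i) = x"
    by (intro exI[of _ "w \<circ> \<psi>"]) (simp add: sum.reindex[OF inj])
next
  assume "\<exists>u. (\<forall>i\<in>V. 0 \<le> u i) \<and> (\<Sum>i\<in>V. u i) = 1 \<and> (\<Sum>i\<in>V. u i *\<^sub>R \<psi> i) = x"
  then obtain u where u: "\<forall>i\<in>V. 0 \<le> u i" "(\<Sum>i\<in>V. u i) = 1" "(\<Sum>i\<in>V. u i *\<^sub>R \<psi> i) = x" by blast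
  show "x \<in> convex hull (\<psi> ` V)"
    unfolding u(3)[symmetric] by (rule convex_sum) (use u finite_V in \<open>auto intro: hull_inc\<close>)
qed

lemma in_rel_interior:
  assumes "\<And>i. i \<in> V \<Longrightarrow> u i > 0" "(\<Sum>i\<in>V. u i) = 1"
  shows "(\<Sum>i\<in>V. u i *\<^sub>R \<psi> i) \<in> rel_interior (convex hull (\<psi> ` V))"
proof -
  define w where "w = u \<circ> inv_into V \<psi>"
  have w: "w (\<psi> j) = u j" if "j \<in> V" for j using inj that by (simp add: w_def)
  have "\<forall>v\<in>\<psi> ` V. w v > 0" "sum w (\<psi> ` V) = 1" "(\<Sum>v\<in>\<psi> ` V. w v *\<^sub>R v) = (\<Sum>i\<in>V. u i *\<^sub>R \<psi> i)"
    using assms w by (simp_all add: sum.reindex[OF inj])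
  then show ?thesis unfolding rel_interior_convex_hull_explicit[OF indep] by blast
qed

text \<open>Barycentric coordinates. On the simplex the choice is unique on \<open>V\<close> by
  \<open>coefficients_eq\<close>; elsewhere it is unspecified.\<close>

definition bc :: "'e \<Rightarrow> 'v \<Rightarrow> real" where
  "bc x = (SOME u. (\<forall>i\<in>V. 0 \<le> u i) \<and> (\<Sum>i\<in>V. u i) = 1 \<and> (\<Sum>i\<in>V. u i *\<^sub>R \<psi> i) = x)"

lemma bc:
  assumes "x \<in> convex hull (\<psi> ` V)"
  shows "i \<in> V \<Longrightarrow> bc x i \<ge> 0" "(\<Sum>i\<in>V. bc x i) = 1" "(\<Sum>i\<in>V. bc x i *\<^sub>R \<psi> i) = x"
  using assms unfolding convex_hull_iff bc_def by (auto dest!: someI_ex)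

lemma bc_eq:
  assumes "x \<in> convex hull (\<psi> ` V)" "(\<Sum>i\<in>V. u i) = 1" "(\<Sum>i\<in>V. u i *\<^sub>R \<psi> i) = x" "i \<in> V"
  shows "bc x i = u i"
  by (rule coefficients_eq) (use bc[OF assms(1)] assms in auto)

lemma convex_combination:
  assumes H: "\<And>w. w \<in> H \<Longrightarrow> p w \<in> convex hull (\<psi> ` V)" and "finite H"
    and a: "\<And>w. w \<in> H \<Longrightarrow> a w \<ge> 0" "(\<Sum>w\<in>H. a w) = 1"
  shows "(\<Sum>w\<in>H. a w *\<^sub>R p w) \<in> convex hull (\<psi> ` V)"
    and "i \<in> V \<Longrightarrow> bc (\<Sum>w\<in>H. a w *\<^sub>R p w) i = (\<Sum>w\<in>H. a w * bc (p w) i)"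
proof -
  show hull: "(\<Sum>w\<in>H. a w *\<^sub>R p w) \<in> convex hull (\<psi> ` V)"
    by (rule convex_sum) (use assms in auto)
  have "(\<Sum>i\<in>V. \<Sum>w\<in>H. a w * bc (p w) i) = (\<Sum>w\<in>H. a w * (\<Sum>i\<in>V. bc (p w) i))"
    unfolding sum_distrib_left by (rule sum.swap)
  also have "\<dots> = 1" using bc(2)[OF H] a by simp
  finally have 1: "(\<Sum>i\<in>V. \<Sum>w\<in>H. a w * bc (p w) i) = 1" .
  have "(\<Sum>i\<in>V. (\<Sum>w\<in>H. a w * bc (p w) i) *\<^sub>R \<psi> i) = (\<Sum>w\<in>H. a w *\<^sub>R (\<Sum>i\<in>V. bc (p w) i *\<^sub>R \<psi> i))"
    unfolding scaleR_sum_left scaleR_sum_right scaleR_scaleR by (rule sum.swap)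
  also have "\<dots> = (\<Sum>w\<in>H. a w *\<^sub>R p w)" using bc(3)[OF H] by simp
  finally have 2: "(\<Sum>i\<in>V. (\<Sum>w\<in>H. a w * bc (p w) i) *\<^sub>R \<psi> i) = (\<Sum>w\<in>H. a w *\<^sub>R p w)" .
  show "bc (\<Sum>w\<in>H. a w *\<^sub>R p w) i = (\<Sum>w\<in>H. a w * bc (p w) i)" if "i \<in> V"
    by (rule bc_eq[OF hull 1 2 that])
qed

text \<open>Extending coordinates on \<open>F\<close> by 0, or omitting zero coordinates, translates
  between the two simplices.\<close>

lemma convex_hull_face_iff:
  assumes F: "F \<subseteq> V" and x: "x \<in> convex hull (\<psi> ` V)"
  shows "x \<in> convex hull (\<psi> ` F) \<longleftrightarrow> {i \<in> V. bc x i > 0} \<subseteq> F"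
proof -
  interpret F: affine_simplex F \<psi>
    using finite_subset[OF F finite_V] inj_on_subset[OF inj F] affine_independent_subset[OF indep image_mono[OF F]]
    by unfold_locales
  show ?thesis
  proof
    assume "x \<in> convex hull (\<psi> ` F)"
    then obtain u where u: "\<forall>i\<in>F. 0 \<le> u i" "(\<Sum>i\<in>F. u i) = 1" "(\<Sum>i\<in>F. u i *\<^sub>R \<psi> i) = x"
      using F.convex_hull_iff by blast
    define v where "v i = (if i \<in> F then u i else 0)" for i
    have "(\<Sum>i\<in>V. v i) = 1" unfolding u(2)[symmetric]
      by (rule sum.mono_neutral_cong_right) (use F finite_V in \<open>auto simp: v_def\<close>)
    moreover have "(\<Sum>i\<in>V. v i *\<^sub>R \<psi> i) = x" unfolding u(3)[symmetric]
      by (rule sum.mono_neutral_cong_right) (use F finite_V in \<open>auto simp: v_def\<close>)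
    ultimately have "bc x i = v i" if "i \<in> V" for i using bc_eq[OF x] that by blast
    then show "{i \<in> V. bc x i > 0} \<subseteq> F" by (auto simp: v_def split: if_splits)
  next
    assume sub: "{i \<in> V. bc x i > 0} \<subseteq> F"
    have z: "bc x i = 0" if "i \<in> V - F" for i using sub that bc(1)[OF x, of i] by force
    have "(\<Sum>i\<in>F. bc x i) = 1" unfolding bc(2)[OF x, symmetric]
      by (rule sum.mono_neutral_left) (use F finite_V z in auto)
    moreover have "(\<Sum>i\<in>F. bc x i *\<^sub>R \<psi> i) = x"
      using sum.mono_neutral_left[of V F "\<lambda>i. bc x i *\<^sub>R \<psi> i"] F finite_V z bc(3)[OF x] by auto
    ultimately show "x \<in> convex hull (\<psi> ` F)" unfolding F.convex_hull_iff using bc(1)[OF x] F by blast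
  qed
qed

text \<open>A convex hull lies in a face iff its vertices do, so the union of their supports is the
  least face.\<close>

lemma carrier_face_eq:
  assumes "\<And>v. v \<in> c \<Longrightarrow> \<theta> v \<in> convex hull (\<psi> ` V)"
  shows "carrier_face \<theta> \<psi> (Pow V) c = {i \<in> V. \<exists>v\<in>c. bc (\<theta> v) i > 0}"
proof -
  have *: "realize \<theta> c \<subseteq> realize \<psi> F \<longleftrightarrow> {i \<in> V. \<exists>v\<in>c. bc (\<theta> v) i > 0} \<subseteq> F" if "F \<subseteq> V" for F
  proof -
    have "realize \<theta> c \<subseteq> realize \<psi> F \<longleftrightarrow> (\<forall>v\<in>c. \<theta> v \<in> convex hull (\<psi> ` F))"
      unfolding realize_def using subset_hull[of convex "convex hull (\<psi> ` F)" "\<theta> ` c"] convex_convex_hull by auto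
    then show ?thesis using convex_hull_face_iff[OF that assms] by blast
  qed
  show ?thesis unfolding carrier_face_def
    by (rule Least_equality) (use * in auto)
qed

end

text \<open>In barycentric coordinates the simplex is the slice of the orthant with coordinate sum
  1, and coning from the origin turns its triangulation into a cone subdivision.\<close>

lemma cone_subdivision_of_triangulation:
  fixes \<psi> :: "'v \<Rightarrow> 'e::euclidean_space" and \<phi> :: "'w \<Rightarrow> 'e"
  assumes tri: "triangulates \<phi> \<Gamma> \<psi> (Pow V)"
  shows "affine_simplex V \<psi>"
    and "\<And>G w. G \<in> \<Gamma> \<Longrightarrow> w \<in> G \<Longrightarrow> \<phi> w \<in> convex hull (\<psi> ` V)"
    and "cone_subdivision V \<Gamma> (\<lambda>w. affine_simplex.bc V \<psi> (\<phi> w))"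
proof -
  have complex: "abstract_complex \<Gamma>" and inj\<Gamma>: "inj_on \<phi> (\<Union>\<Gamma>)"
    and ind\<Gamma>: "\<And>G. G \<in> \<Gamma> \<Longrightarrow> \<not> affine_dependent (\<phi> ` G)"
    and simp\<Gamma>: "simplicial_complex (realize \<phi> ` \<Gamma>)"
    and finV: "finite V" and injV: "inj_on \<psi> V" and indV: "\<not> affine_dependent (\<psi> ` V)"
    and sub: "geom_subdivides (realize \<phi> ` \<Gamma>) (realize \<psi> ` Pow V)"
    using tri unfolding triangulates_def geom_realization_def abstract_complex_def by auto
  show simplex: "affine_simplex V \<psi>" by unfold_locales (fact finV injV indV)+
  interpret affine_simplex V \<psi> by (rule simplex)
  have face: "affine_simplex G \<phi>" if "G \<in> \<Gamma>" for G
    using that complex ind\<Gamma> inj\<Gamma> by unfold_locales (auto simp: abstract_complex_def intro: inj_on_subset)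
  have "(\<Union>F\<in>Pow V. realize \<psi> F) = convex hull (\<psi> ` V)"
    unfolding realize_def using hull_mono[of _ "\<psi> ` V" convex] by blast
  then have union: "(\<Union>G\<in>\<Gamma>. convex hull (\<phi> ` G)) = convex hull (\<psi> ` V)"
    using sub unfolding geom_subdivides_def realize_def by auto
  show in_hull: "\<phi> w \<in> convex hull (\<psi> ` V)" if "G \<in> \<Gamma>" "w \<in> G" for G w
    using that union hull_inc[of "\<phi> w" "\<phi> ` G" convex] by auto
  let ?l = "\<lambda>w. bc (\<phi> w)"
  \<comment> \<open>This and the next fact turn a linear relation between generators into equal
    coefficient sums and equal points of the ambient space.\<close>
  have sum_l: "(\<Sum>i\<in>V. \<Sum>w\<in>G. a w * ?l w i) = (\<Sum>w\<in>G. a w)" if "G \<in> \<Gamma>" for G a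
  proof -
    have "(\<Sum>i\<in>V. \<Sum>w\<in>G. a w * ?l w i) = (\<Sum>w\<in>G. a w * (\<Sum>i\<in>V. ?l w i))"
      unfolding sum_distrib_left by (rule sum.swap)
    also have "\<dots> = (\<Sum>w\<in>G. a w)" using bc(2)[OF in_hull[OF that]] by simp
    finally show ?thesis .
  qed
  have sum_\<phi>: "(\<Sum>i\<in>V. (\<Sum>w\<in>G. a w * ?l w i) *\<^sub>R \<psi> i) = (\<Sum>w\<in>G. a w *\<^sub>R \<phi> w)" if "G \<in> \<Gamma>" for G a
  proof -
    have "(\<Sum>i\<in>V. (\<Sum>w\<in>G. a w * ?l w i) *\<^sub>R \<psi> i) = (\<Sum>w\<in>G. a w *\<^sub>R (\<Sum>i\<in>V. ?l w i *\<^sub>R \<psi> i))"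
      unfolding scaleR_sum_left scaleR_sum_right scaleR_scaleR by (rule sum.swap)
    also have "\<dots> = (\<Sum>w\<in>G. a w *\<^sub>R \<phi> w)" using bc(3)[OF in_hull[OF that]] by simp
    finally show ?thesis .
  qed
  show "cone_subdivision V \<Gamma> ?l"
  proof
    show "finite V" by (rule finV)
    show "abstract_complex \<Gamma>" by (rule complex)
    show "0 \<le> ?l w i" if "G \<in> \<Gamma>" "w \<in> G" "i \<in> V" for G w i
      using bc(1) in_hull that by blast
    show "a w = 0" if G: "G \<in> \<Gamma>" and s: "\<And>i. i \<in> V \<Longrightarrow> (\<Sum>w\<in>G. a w * ?l w i) = 0" and w: "w \<in> G" for G a w
    proof (rule affine_simplex.coefficients_zero[OF face[OF G] _ _ w])
      show "(\<Sum>w\<in>G. a w) = 0" using sum_l[OF G, of a] s by simp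
      show "(\<Sum>w\<in>G. a w *\<^sub>R \<phi> w) = 0" using sum_\<phi>[OF G, of a] s by simp
    qed
    show "\<exists>G\<in>\<Gamma>. \<exists>a. (\<forall>w\<in>G. a w \<ge> 0) \<and> (\<forall>i\<in>V. \<xi> i = (\<Sum>w\<in>G. a w * ?l w i))"
      if \<xi>: "\<And>i. i \<in> V \<Longrightarrow> \<xi> i \<ge> 0" for \<xi>
    proof (cases "(\<Sum>i\<in>V. \<xi> i) = 0")
      case True
      then have "\<xi> i = 0" if "i \<in> V" for i using sum_nonneg_eq_0_iff[OF finV] \<xi> that by blast
      then show ?thesis using complex by (intro bexI[of _ "{}"]) (auto simp: abstract_complex_def)
    next
      case False
      \<comment> \<open>Dividing by the coordinate sum moves a nonzero vector into the simplex; the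
        zero vector was covered by the empty face.\<close>
      define s where "s = (\<Sum>i\<in>V. \<xi> i)"
      have s: "s > 0" using False sum_nonneg[of V \<xi>] \<xi> unfolding s_def by force
      define p where "p = (\<Sum>i\<in>V. (\<xi> i / s) *\<^sub>R \<psi> i)"
      have s1: "(\<Sum>i\<in>V. \<xi> i / s) = 1" using s by (simp add: s_def flip: sum_divide_distrib)
      have p: "p \<in> convex hull (\<psi> ` V)"
        unfolding convex_hull_iff p_def using s s1 \<xi> by (intro exI[of _ "\<lambda>i. \<xi> i / s"]) auto
      then obtain G where G: "G \<in> \<Gamma>" "p \<in> convex hull (\<phi> ` G)" using union by blast
      then obtain b where b: "\<forall>w\<in>G. 0 \<le> b w" "(\<Sum>w\<in>G. b w) = 1" "(\<Sum>w\<in>G. b w *\<^sub>R \<phi> w) = p"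
        using affine_simplex.convex_hull_iff[OF face[OF G(1)]] by blast
      have "\<xi> i = (\<Sum>w\<in>G. s * b w * ?l w i)" if i: "i \<in> V" for i
      proof -
        have "\<xi> i / s = (\<Sum>w\<in>G. b w * ?l w i)"
          by (rule coefficients_eq[OF _ _ i]) (use s1 sum_l[OF G(1)] sum_\<phi>[OF G(1)] b p_def in auto)
        then have "\<xi> i = s * (\<Sum>w\<in>G. b w * ?l w i)" using s by (simp add: field_simps)
        then show ?thesis by (simp add: sum_distrib_left mult.assoc)
      qed
      then show ?thesis using G(1) b s by (intro bexI[of _ G] exI[of _ "\<lambda>w. s * b w"]) auto
    qed
    show "G = H" if G: "G \<in> \<Gamma>" and H: "H \<in> \<Gamma>" and a: "\<And>w. w \<in> G \<Longrightarrow> a w > 0" and b: "\<And>w. w \<in> H \<Longrightarrow> b w > 0"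
      and eq: "\<And>i. i \<in> V \<Longrightarrow> (\<Sum>w\<in>G. a w * ?l w i) = (\<Sum>w\<in>H. b w * ?l w i)" for G H a b
    proof -
      have fin: "finite G" "finite H" using G H complex by (auto simp: abstract_complex_def)
      define s where "s = (\<Sum>w\<in>G. a w)"
      have sH: "s = (\<Sum>w\<in>H. b w)" using sum_l[OF G, of a] sum_l[OF H, of b] eq by (simp add: s_def)
      have pt: "(\<Sum>w\<in>G. a w *\<^sub>R \<phi> w) = (\<Sum>w\<in>H. b w *\<^sub>R \<phi> w)"
        using sum_\<phi>[OF G, of a] sum_\<phi>[OF H, of b] eq by simp
      show ?thesis
      proof (cases "s = 0")
        case True
        have "G = {}" using sum_pos[OF fin(1), of a] a True s_def by force
        moreover have "H = {}" using sum_pos[OF fin(2), of b] b True sH by force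
        ultimately show ?thesis by simp
      next
        case False
        then have s: "s > 0" using sum_nonneg[of G a] a unfolding s_def by (force intro: less_imp_le)
        define p where "p = (\<Sum>w\<in>G. (a w / s) *\<^sub>R \<phi> w)"
        have p': "p = (\<Sum>w\<in>H. (b w / s) *\<^sub>R \<phi> w)"
          using arg_cong[OF pt, of "\<lambda>x. (1 / s) *\<^sub>R x"] by (simp add: p_def scaleR_sum_right)
        have pG: "p \<in> rel_interior (convex hull (\<phi> ` G))" unfolding p_def
          by (rule affine_simplex.in_rel_interior[OF face[OF G]]) (use a s in \<open>auto simp: s_def simp flip: sum_divide_distrib\<close>)
        have pH: "p \<in> rel_interior (convex hull (\<phi> ` H))" unfolding p'
          by (rule affine_simplex.in_rel_interior[OF face[OF H]]) (use b s in \<open>auto simp: sH simp flip: sum_divide_distrib\<close>)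
        \<comment> \<open>The point \<open>p\<close> is in both relative interiors. The intersection
          is a face of either simplex and meets its relative interior, hence is all of it.\<close>
        have faces: "convex hull (\<phi> ` A) \<inter> convex hull (\<phi> ` B) face_of convex hull (\<phi> ` A)"
          if "A \<in> \<Gamma>" "B \<in> \<Gamma>" for A B
          using simp\<Gamma> that unfolding simplicial_complex_def realize_def by blast
        have pGH: "p \<in> convex hull (\<phi> ` G)" "p \<in> convex hull (\<phi> ` H)"
          using pG pH rel_interior_subset by blast+
        have "convex hull (\<phi> ` G) \<subseteq> convex hull (\<phi> ` G) \<inter> convex hull (\<phi> ` H)"
          by (rule subset_of_face_of[OF faces[OF G H] order.refl]) (use pG pGH in blast)
        moreover have "convex hull (\<phi> ` H) \<subseteq> convex hull (\<phi> ` H) \<inter> convex hull (\<phi> ` G)"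
          by (rule subset_of_face_of[OF faces[OF H G] order.refl]) (use pH pGH in blast)
        ultimately have "convex hull (\<phi> ` G) = convex hull (\<phi> ` H)" by blast
        \<comment> \<open>Affine independence makes the vertices the extreme points, so equal hulls
          have equal vertices.\<close>
        then have "\<phi> ` G = \<phi> ` H"
          using extreme_point_of_convex_hull_affine_independent[OF ind\<Gamma>[OF G]]
            extreme_point_of_convex_hull_affine_independent[OF ind\<Gamma>[OF H]] by auto
        then show ?thesis using inj_on_image_eq_iff[OF inj\<Gamma>, of G H] G H by blast
      qed
    qed
  qed
qed

theorem theorem1p1:
  fixes V :: "'v set" and \<Gamma> :: "'w set set"
    and \<psi> :: "'v \<Rightarrow> 'e::euclidean_space" and \<phi> :: "'w \<Rightarrow> 'e"
    and n :: nat
  assumes "card V = n" and "n \<ge> 1"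
    and "triangulates \<phi> \<Gamma> \<psi> (Pow V)"
  shows "real_rooted (local_h_poly (barycenter \<phi>) (sd \<Gamma>) \<psi> V) \<and>
         eulerian_poly n \<preceq> local_h_poly (barycenter \<phi>) (sd \<Gamma>) \<psi> V"
proof -
  interpret affine_simplex V \<psi> by (rule cone_subdivision_of_triangulation(1)[OF assms(3)])
  note in_hull = cone_subdivision_of_triangulation(2)[OF assms(3)]
  interpret C: cone_subdivision V \<Gamma> "\<lambda>w. bc (\<phi> w)"
    by (rule cone_subdivision_of_triangulation(3)[OF assms(3)])
  \<comment> \<open>A barycenter has equal positive weights, so its support is the union of the
    supports of the vertices.\<close>
  have bary: "barycenter \<phi> H \<in> convex hull (\<psi> ` V)"
    "i \<in> V \<Longrightarrow> bc (barycenter \<phi> H) i > 0 \<longleftrightarrow> (\<exists>w\<in>H. bc (\<phi> w) i > 0)"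
    if H: "H \<in> \<Gamma>" "H \<noteq> {}" for H i
  proof -
    have fin: "finite H" using C.finite_face[OF H(1)] .
    have eq: "barycenter \<phi> H = (\<Sum>w\<in>H. (1 / real (card H)) *\<^sub>R \<phi> w)"
      by (simp add: barycenter_def scaleR_sum_right)
    have s1: "(\<Sum>w\<in>H. 1 / real (card H)) = 1" using fin H by simp
    note comb = convex_combination[OF in_hull[OF H(1)] fin _ s1]
    show "barycenter \<phi> H \<in> convex hull (\<psi> ` V)" unfolding eq by (rule comb) auto
    assume i: "i \<in> V"
    have "bc (barycenter \<phi> H) i = (\<Sum>w\<in>H. 1 / real (card H) * bc (\<phi> w) i)" unfolding eq by (rule comb) (use i in auto)
    then have "bc (barycenter \<phi> H) i = (\<Sum>w\<in>H. bc (\<phi> w) i) / real (card H)" by (simp add: sum_divide_distrib)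
    moreover have "card H > 0" using fin H by (simp add: card_gt_0_iff)
    ultimately have "bc (barycenter \<phi> H) i > 0 \<longleftrightarrow> (\<Sum>w\<in>H. bc (\<phi> w) i) > 0" by (simp add: zero_less_divide_iff)
    also have "\<dots> \<longleftrightarrow> (\<exists>w\<in>H. bc (\<phi> w) i > 0)"
    proof
      assume "(\<Sum>w\<in>H. bc (\<phi> w) i) > 0"
      then show "\<exists>w\<in>H. bc (\<phi> w) i > 0" using sum_nonpos[of H "\<lambda>w. bc (\<phi> w) i"] by force
    next
      assume "\<exists>w\<in>H. bc (\<phi> w) i > 0"
      then show "(\<Sum>w\<in>H. bc (\<phi> w) i) > 0" using C.nonneg[OF H(1) _ i] fin by (auto intro: sum_pos2)
    qed
    finally show "bc (barycenter \<phi> H) i > 0 \<longleftrightarrow> (\<exists>w\<in>H. bc (\<phi> w) i > 0)" .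
  qed
  \<comment> \<open>The supports of the barycenters in a chain combine to the carrier of its top
    face.\<close>
  have "carrier_face (barycenter \<phi>) \<psi> (Pow V) c = C.carr (\<Union>c)" if c: "c \<in> sd \<Gamma>" for c
  proof -
    have H: "H \<in> \<Gamma>" "H \<noteq> {}" if "H \<in> c" for H using sdD[OF C.complex c] that by auto
    have "carrier_face (barycenter \<phi>) \<psi> (Pow V) c = {i \<in> V. \<exists>H\<in>c. bc (barycenter \<phi> H) i > 0}"
      by (rule carrier_face_eq) (use bary(1) H in blast)
    also have "\<dots> = C.carr (\<Union>c)" unfolding C.carr_def using bary(2) H by blast
    finally show ?thesis .
  qed
  then have "restrict_to (barycenter \<phi>) (sd \<Gamma>) \<psi> (Pow V) F = {c \<in> sd \<Gamma>. C.carr (\<Union>c) \<subseteq> F}" for F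
    unfolding restrict_to_def by auto
  then have "local_h_poly (barycenter \<phi>) (sd \<Gamma>) \<psi> V = C.local_h" by (rule C.local_h_poly_sd)
  moreover have "V \<noteq> {}" using assms by auto
  ultimately show ?thesis using C.eulerian_interlaces_local_h assms(1) by simp
qed

end
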